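(* Let $0<\lambda<n$ and let $b\in\operatorname{BMO}(\mathbb{R}^n)$ be such that $b^-\in L_\infty(\mathbb{R}^n)$. Then the operator $[M,b]$ is bounded from $\mathcal{M}_{L(1+\log^+L),\lambda}$ to $W\mathcal{M}_{L(1+\log^+L),\lambda}$, and the inequality $$\|[M,b]f\|_{W\mathcal{M}_{L(1+\log^+L),\lambda}}\le c\left(\|b^+\|_*+\|b^-\|_{L_\infty}\right)\|f\|_{\mathcal{M}_{L(1+\log^+L),\lambda}}$$ holds with a positive constant $c$ independent of $f$.
   Context: Cubes in $\mathbb{R}^n$ have sides parallel to the coordinate axes; $\log^+t=\max\{\log t,0\}$; $f_Q=\frac1{|Q|}\int_Q f$; $b^+=\max\{b,0\}$, $b^-=-\min\{b,0\}$. $M$ is the Hardy-Littlewood maximal operator $Mf(x)=\sup_{Q\ni x}\frac1{|Q|}\int_Q|f(y)|\,dy$ (supremum over all cubes containing $x$). The commutator of $M$ and $b$ is $[M,b]f(x):=M(bf)(x)-b(x)Mf(x)$. $\operatorname{BMO}(\mathbb{R}^n)$ is the set of locally integrable $f$ with $\|f\|_*:=\sup_Q\frac1{|Q|}\int_Q|f(y)-f_Q|\,dy<\infty$ (supremum over all cubes). For a cube $Q$ and measurable $g$: $\|g\|_{L(1+\log^+L),Q}:=\inf\{\alpha>0:\frac1{|Q|}\int_Q\frac{|g(x)|}{\alpha}\left(1+\log^+\frac{|g(x)|}{\alpha}\right)dx\le1\}$, $\|g\|_{WL(1+\log^+L),Q}:=\inf\left\{\alpha>0:\sup_{t>0}\frac1{|Q|}\frac{|\{x\in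 Q:|g(x)|>\alpha t\}|}{\frac1t\left(1+\log^+\frac1t\right)}\le1\right\}$. For $0<\lambda<n$, the Zygmund-Morrey space $\mathcal{M}_{L(1+\log^+L),\lambda}$ (also written $\mathcal M_{L(\log L),\lambda}$) and the weak Zygmund-Morrey space $W\mathcal{M}_{L(1+\log^+L),\lambda}$ consist of the measurable functions $f$ on $\mathbb{R}^n$ for which, respectively, $\|f\|_{\mathcal{M}_{L(1+\log^+L),\lambda}}:=\sup_Q|Q|^{\lambda/n}\|f\|_{L(1+\log^+L),Q}<\infty$ and $\|f\|_{W\mathcal{M}_{L(1+\log^+L),\lambda}}:=\sup_Q|Q|^{\lambda/n}\|f\|_{WL(1+\log^+L),Q}<\infty$ (suprema over all cubes $Q$). *)

theory Defs
  imports "HOL-Analysis.Analysis" "HOL-Probability.Essential_Supremum"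
begin

text \<open>All measure-theoretic notions refer to Lebesgue measure on \<open>real ^ 'n\<close>, \<open>n = CARD('n)\<close>.
  Norms take values in \<^typ>\<open>ennreal\<close>; membership in a space means that the function is
  measurable (or locally integrable) and its norm is finite.\<close>

definition cubes :: "(real ^ 'n) set set" where
  "cubes = {cbox a (\<chi> i. a $ i + r) | a r. 0 < r}"

definition logplus :: "real \<Rightarrow> real" where
  "logplus t = max (ln t) 0"
  \<comment> \<open>Since \<open>ln 0 = 0\<close> in HOL, \<open>logplus 0 = 0\<close>, in agreement with \<open>log 0 = -\<infinity>\<close>.\<close>

definition pos_part :: "('a \<Rightarrow> real) \<Rightarrow> 'a \<Rightarrow> real" where
  "pos_part b x = max (b x) 0"

definition neg_part :: "('a \<Rightarrow> real) \<Rightarrow> 'a \<Rightarrow> real" where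
  "neg_part b x = - min (b x) 0"

definition average :: "(real ^ 'n) set \<Rightarrow> (real ^ 'n \<Rightarrow> real) \<Rightarrow> real" where
  "average Q f = (LINT y:Q|lebesgue. f y) / measure lebesgue Q"

definition maximal :: "(real ^ 'n \<Rightarrow> real) \<Rightarrow> real ^ 'n \<Rightarrow> ennreal" where
  "maximal f x =
     (SUP Q \<in> {Q \<in> cubes. x \<in> Q}.
        (\<integral>\<^sup>+y\<in>Q. ennreal \<bar>f y\<bar> \<partial>lebesgue) / emeasure lebesgue Q)"

text \<open>The maximal functions may be infinite at some points, so the commutator is valued in
  \<^typ>\<open>ereal\<close>. Where the difference is undefined, the convention \<open>\<infinity> - \<infinity> = \<infinity>\<close> applies: such points
  are counted in every level set of the commutator and are not discarded.\<close>

definition commutator_max :: "(real ^ 'n \<Rightarrow> real) \<Rightarrow> (real ^ 'n \<Rightarrow> real) \<Rightarrow> real ^ 'n \<Rightarrow> ereal" where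
  "commutator_max b f x =
     enn2ereal (maximal (\<lambda>y. b y * f y) x) - ereal (b x) * enn2ereal (maximal f x)"

definition locally_integrable :: "(real ^ 'n \<Rightarrow> real) \<Rightarrow> bool" where
  "locally_integrable f \<longleftrightarrow> (\<forall>K. compact K \<longrightarrow> f absolutely_integrable_on K)"

definition bmo_norm :: "(real ^ 'n \<Rightarrow> real) \<Rightarrow> ennreal" where
  "bmo_norm f =
     (SUP Q \<in> cubes. (\<integral>\<^sup>+y\<in>Q. ennreal \<bar>f y - average Q f\<bar> \<partial>lebesgue) / emeasure lebesgue Q)"

definition BMO :: "(real ^ 'n \<Rightarrow> real) set" where
  "BMO = {f. locally_integrable f \<and> bmo_norm f < \<infinity>}"

definition Linfty_norm :: "(real ^ 'n \<Rightarrow> real) \<Rightarrow> ennreal" where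
  "Linfty_norm f = esssup lebesgue (\<lambda>x. ennreal \<bar>f x\<bar>)"

definition Linfty :: "(real ^ 'n \<Rightarrow> real) set" where
  "Linfty = {f \<in> borel_measurable lebesgue. Linfty_norm f < \<infinity>}"

text \<open>The infima over \<open>\<alpha> > 0\<close> are taken in \<^typ>\<open>ennreal\<close>, so that an empty set of admissible
  \<open>\<alpha>\<close> gives the value \<open>\<infinity>\<close>.\<close>

definition LlogL_norm :: "(real ^ 'n) set \<Rightarrow> (real ^ 'n \<Rightarrow> real) \<Rightarrow> ennreal" where
  "LlogL_norm Q g =
     (INF \<alpha> \<in> {\<alpha>::real. 0 < \<alpha> \<and>
        (\<integral>\<^sup>+x\<in>Q. ennreal (\<bar>g x\<bar> / \<alpha> * (1 + logplus (\<bar>g x\<bar> / \<alpha>))) \<partial>lebesgue)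
          / emeasure lebesgue Q \<le> 1}. ennreal \<alpha>)"

definition weak_LlogL_norm :: "(real ^ 'n) set \<Rightarrow> (real ^ 'n \<Rightarrow> ereal) \<Rightarrow> ennreal" where
  "weak_LlogL_norm Q g =
     (INF \<alpha> \<in> {\<alpha>::real. 0 < \<alpha> \<and>
        (SUP t \<in> {0::real<..}.
           emeasure lebesgue {x \<in> Q. ereal (\<alpha> * t) < \<bar>g x\<bar>} / emeasure lebesgue Q
             / ennreal (1 / t * (1 + logplus (1 / t)))) \<le> 1}. ennreal \<alpha>)"

definition ZM_norm :: "real \<Rightarrow> (real ^ 'n \<Rightarrow> real) \<Rightarrow> ennreal" where
  "ZM_norm lam f =
     (SUP Q \<in> cubes.
        ennreal (measure lebesgue Q powr (lam / real CARD('n))) * LlogL_norm Q f)"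

definition ZM :: "real \<Rightarrow> (real ^ 'n \<Rightarrow> real) set" where
  "ZM lam = {f \<in> borel_measurable lebesgue. ZM_norm lam f < \<infinity>}"

definition WZM_norm :: "real \<Rightarrow> (real ^ 'n \<Rightarrow> ereal) \<Rightarrow> ennreal" where
  "WZM_norm lam g =
     (SUP Q \<in> cubes.
        ennreal (measure lebesgue Q powr (lam / real CARD('n))) * weak_LlogL_norm Q g)"

definition WZM :: "real \<Rightarrow> (real ^ 'n \<Rightarrow> ereal) set" where
  "WZM lam = {g \<in> borel_measurable lebesgue. WZM_norm lam g < \<infinity>}"

end

theory Submission
  imports Defs
begin

text \<open>The argument rests on two reductions. In the weak Zygmund norm the denominator
  \<open>1/t (1 + log\<^sup>+ (1/t))\<close> is at least \<open>1/t\<close>, so this norm over a cube is dominated by a weak \<open>L\<^sup>1\<close> average: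
  it suffices to bound \<open>|{x \<in> Q. \<bar>[M,b]f x\<bar> > \<tau>}|\<close> by a constant times
  \<open>B N |Q|\<^bsup>-\<lambda>/n\<^esup> |Q| / \<tau>\<close>, where \<open>B\<close> bounds \<open>\<parallel>b\<^sup>+\<parallel>\<^sub>*\<close> and \<open>\<parallel>b\<^sup>-\<parallel>\<^sub>\<infinity>\<close>, and \<open>N\<close> bounds the
  Zygmund-Morrey norm of \<open>f\<close>. Second, \<open>|b| = b\<^sup>+ + b\<^sup>-\<close> gives, almost everywhere,
  \<open>\<bar>[M,b]f\<bar> \<le> C f + 2 \<parallel>b\<^sup>-\<parallel>\<^sub>\<infinity> Mf\<close> with the maximal commutator
  \<open>C f x = sup\<^bsub>R \<ni> x\<^esub> |R|\<^sup>-\<^sup>1 \<integral>\<^sub>R |\<beta> x - \<beta> y| |f y| dy\<close> of \<open>\<beta> = b\<^sup>+\<close> (\<open>commutator_max_le\<close>).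

  The weak bound for \<open>C f\<close> on \<open>Q\<close> separates the cubes \<open>R\<close> by size. If \<open>R\<close> is at least as large as
  \<open>Q\<close>, it is replaced by its triple, which contains \<open>Q\<close>; the distance of the averages of \<open>\<beta>\<close> over \<open>Q\<close> and
  over the triple grows only logarithmically in the ratio of the sides, which the factor \<open>|R|\<^bsup>-\<lambda>/n\<^esup>\<close>
  absorbs, and what is left is \<open>\<bar>\<beta> x - \<beta>\<^sub>Q\<bar>\<close>, to which Markov's inequality applies (\<open>large_cubes\<close>).
  If \<open>R\<close> is smaller than \<open>Q\<close>, it lies in the triple of \<open>Q\<close>, and \<open>|\<beta> x - \<beta> y|\<close> is split at \<open>\<beta>\<^sub>R\<close>. The
  mean of \<open>|\<beta> - \<beta>\<^sub>R| |f|\<close> is handled by Young's inequality for the pair \<open>exp\<close>, \<open>L log L\<close> and the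
  covering lemma (\<open>small_cubes_pairing\<close>). The term \<open>|\<beta> x - \<beta>\<^sub>R| |f|\<^sub>R\<close> is the delicate one, as \<open>\<beta> x\<close> is
  unbounded; but if \<open>|f|\<^sub>R\<close> is about \<open>\<sigma>/m\<close> then \<open>|\<beta> x - \<beta>\<^sub>R|\<close> is at least of order \<open>m B\<close>, so that \<open>x\<close> lies in
  an exceptional set of relative size \<open>2\<^sup>-\<^sup>m\<close>, and the weak type \<open>(1,1)\<close> bounds \<open>O(m/\<sigma>)\<close> can be summed
  against \<open>2\<^sup>-\<^sup>m\<close> (\<open>small_cubes_pointwise\<close>).

  All of this needs exponential decay of the oscillation of \<open>\<beta>\<close>, and in a form that controls the averages
  over all subcubes of a given cube simultaneously. That version of the John-Nirenberg inequality
  (\<open>John_Nirenberg_cubes\<close>) is obtained by iterating a Vitali selection among nearly maximal subcubes,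
  with no dyadic structure. Bad sets are only ever covered by measurable sets, so that
  their own measurability is not an issue.\<close>

text \<open>This rule would rewrite Lebesgue measure into Borel measure of an unspecified main part.\<close>

declare emeasure_completion [simp del]

section \<open>Cubes and a Vitali covering lemma\<close>

definition cube :: "real ^ 'n \<Rightarrow> real \<Rightarrow> (real ^ 'n) set" where
  "cube a r = cbox a (\<chi> i. a $ i + r)"

text \<open>The concentric cube with side \<open>2 k + 1\<close> times as long: each face moves outwards by \<open>k\<close> side lengths.\<close>

definition dilate :: "real \<Rightarrow> real ^ 'n \<Rightarrow> real \<Rightarrow> (real ^ 'n) set" where
  "dilate k a r = cube (\<chi> i. a $ i - k * r) ((2 * k + 1) * r)"

lemma cubes_eq: "cubes = {cube a r | a r. 0 < r}"
  by (simp add: cubes_def cube_def)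

lemma cube_in_cubes: "0 < r \<Longrightarrow> cube a r \<in> cubes"
  by (auto simp: cubes_eq)

lemma mem_cube: "x \<in> cube a r \<longleftrightarrow> (\<forall>i. a $ i \<le> x $ i \<and> x $ i \<le> a $ i + r)"
  by (simp add: cube_def mem_box_cart)

lemma cube_measurable [measurable, simp]: "cube a r \<in> sets lebesgue"
  by (simp add: cube_def)

lemma emeasure_cube:
  fixes a :: "real ^ 'n::finite"
  assumes "0 \<le> r"
  shows "emeasure lebesgue (cube a r) = ennreal (r ^ CARD('n))"
proof -
  have "emeasure lborel (cube a r) = ennreal (measure lborel (cube a r))"
    using emeasure_lborel_cbox_finite[of a "\<chi> i. a $ i + r"]
    by (simp add: cube_def emeasure_eq_ennreal_measure less_top)
  moreover have "emeasure lebesgue (cube a r) = emeasure lborel (cube a r)"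
    by (simp add: cube_def main_part_sets emeasure_completion)
  moreover have "measure lborel (cube a r) = r ^ CARD('n)"
    using assms by (simp add: cube_def content_cbox_if_cart interval_eq_empty_cart)
  ultimately show ?thesis by simp
qed

lemma measure_cube:
  fixes a :: "real ^ 'n::finite"
  assumes "0 \<le> r"
  shows "measure lebesgue (cube a r) = r ^ CARD('n)"
  using assms unfolding measure_def by (subst emeasure_cube) auto

lemma cube_subset_iff:
  assumes "0 \<le> r"
  shows "cube a r \<subseteq> cube c s \<longleftrightarrow> (\<forall>i. c $ i \<le> a $ i \<and> a $ i + r \<le> c $ i + s)"
proof -
  have "\<forall>i. a $ i \<le> (\<chi> i. a $ i + r) $ i" using assms by simp
  then show ?thesis unfolding cube_def subset_interval_cart using assms by auto
qed

lemma cube_subset_side: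
  assumes "0 \<le> r" "cube a r \<subseteq> cube c s"
  shows "r \<le> s"
proof -
  have "c $ undefined \<le> a $ undefined \<and> a $ undefined + r \<le> c $ undefined + s"
    using assms by (simp add: cube_subset_iff)
  then show ?thesis by linarith
qed

lemma mem_dilate:
  "x \<in> dilate k a r \<longleftrightarrow> (\<forall>i. a $ i - k * r \<le> x $ i \<and> x $ i \<le> a $ i + (k + 1) * r)"
  by (simp add: dilate_def mem_cube algebra_simps)

lemma cube_subset_dilate1:
  assumes "r \<le> s" "x \<in> cube a r" "x \<in> cube c s"
  shows "cube a r \<subseteq> dilate 1 c s"
proof
  fix y assume y: "y \<in> cube a r"
  show "y \<in> dilate 1 c s"
    unfolding mem_dilate
  proof
    fix i
    have "a $ i \<le> x $ i" "x $ i \<le> a $ i + r" "c $ i \<le> x $ i" "x $ i \<le> c $ i + s" 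
      "a $ i \<le> y $ i" "y $ i \<le> a $ i + r"
      using assms y by (auto simp: mem_cube)
    then show "c $ i - 1 * s \<le> y $ i \<and> y $ i \<le> c $ i + (1 + 1) * s" using assms(1) by auto
  qed
qed


text \<open>Euclidean balls circumscribed about the cubes reduce the claim to the Vitali lemma for balls: disjoint
  balls contain disjoint cubes, and a ball of five times the radius \<open>n r / 2\<close> lies in the dilated cube. The
  covering lands in the interior so that Lebesgue points never sit on the boundary of a selected cube.\<close>

lemma Vitali_cubes:
  fixes F :: "((real ^ 'n::finite) \<times> real) set"
  assumes F: "\<And>a r. (a, r) \<in> F \<Longrightarrow> 0 < r \<and> r \<le> D"
  obtains C where "countable C" "C \<subseteq> F"
    "disjoint_family_on (\<lambda>(c, s). cube c s) C"
    "\<And>a r. (a, r) \<in> F \<Longrightarrow>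
       \<exists>(c, s)\<in>C. cube a r \<subseteq> interior (dilate (3 * real CARD('n)) c s)"
proof -
  define n where "n = real CARD('n)"
  have n1: "n \<ge> 1" using zero_less_card_finite[where 'a='n] unfolding n_def by linarith
  define ctr where "ctr = (\<lambda>(a, r). (\<chi> i. a $ i + r / 2) :: real ^ 'n)"
  define rad where "rad = (\<lambda>(a :: real ^ 'n, r). n * r / 2)"
  have rad: "0 < rad i \<and> rad i \<le> n * D / 2" if "i \<in> F" for i
    using F[of "fst i" "snd i"] that n1 by (auto simp: rad_def split: prod.splits)
  obtain C where C: "countable C" "C \<subseteq> F"
    "pairwise (\<lambda>i j. disjnt (cball (ctr i) (rad i)) (cball (ctr j) (rad j))) C"
    "\<And>i. i \<in> F \<Longrightarrow> \<exists>j. j \<in> C \<and> \<not> disjnt (cball (ctr i) (rad i)) (cball (ctr j) (rad j)) \<and>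
                        cball (ctr i) (rad i) \<subseteq> ball (ctr j) (5 * rad j)"
    by (rule Vitali_covering_lemma_cballs_balls[of F rad "n * D / 2" ctr, OF rad]) (blast intro: that)+
  have in_ball: "cube a r \<subseteq> cball (ctr (a, r)) (rad (a, r))" for a r
  proof
    fix x assume x: "x \<in> cube a r"
    have "norm (ctr (a, r) - x) \<le> (\<Sum>i\<in>UNIV. \<bar>(ctr (a, r) - x) $ i\<bar>)"
      by (rule norm_le_l1_cart)
    also have "\<dots> \<le> (\<Sum>i\<in>(UNIV :: 'n set). r / 2)"
    proof (rule sum_mono)
      fix i :: 'n
      have "a $ i \<le> x $ i" "x $ i \<le> a $ i + r" using x by (auto simp: mem_cube)
      then show "\<bar>(ctr (a, r) - x) $ i\<bar> \<le> r / 2" by (simp add: ctr_def abs_le_iff field_simps)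
    qed
    also have "\<dots> = rad (a, r)" by (simp add: rad_def n_def)
    finally show "x \<in> cball (ctr (a, r)) (rad (a, r))" by (simp add: dist_norm)
  qed
  have in_dil: "ball (ctr (c, s)) (5 * rad (c, s)) \<subseteq> interior (dilate (3 * n) c s)" if "0 < s" for c s
  proof (rule interior_maximal)
    show "ball (ctr (c, s)) (5 * rad (c, s)) \<subseteq> dilate (3 * n) c s"
    proof
      fix x assume "x \<in> ball (ctr (c, s)) (5 * rad (c, s))"
      then have *: "norm (ctr (c, s) - x) < 5 * (n * s / 2)" by (simp add: dist_norm rad_def)
      show "x \<in> dilate (3 * n) c s"
        unfolding mem_dilate
      proof
        fix i
        have "\<bar>(ctr (c, s) - x) $ i\<bar> < 5 * (n * s / 2)"
          using component_le_norm_cart[of "ctr (c, s) - x" i] * by linarith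
        then have "\<bar>c $ i + s / 2 - x $ i\<bar> < 5 * (n * s / 2)" by (simp add: ctr_def)
        moreover have "n * s \<ge> s" using n1 that by simp
        moreover have "3 * n * s = 3 * (n * s)" "(3 * n + 1) * s = 3 * (n * s) + s"
          by (simp_all add: algebra_simps)
        ultimately show "c $ i - 3 * n * s \<le> x $ i \<and> x $ i \<le> c $ i + (3 * n + 1) * s"
          using that unfolding abs_less_iff by linarith
      qed
    qed
  qed simp
  show thesis
  proof (rule that[of C])
    show "countable C" "C \<subseteq> F" by fact+
    show "disjoint_family_on (\<lambda>(c, s). cube c s) C"
      unfolding disjoint_family_on_def
    proof (intro ballI impI)
      fix i j assume "i \<in> C" "j \<in> C" "i \<noteq> j"
      then have "disjnt (cball (ctr i) (rad i)) (cball (ctr j) (rad j))"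
        using C(3) unfolding pairwise_def by blast
      then show "(\<lambda>(c, s). cube c s) i \<inter> (\<lambda>(c, s). cube c s) j = {}"
        using in_ball[of "fst i" "snd i"] in_ball[of "fst j" "snd j"] 
        unfolding disjnt_def by (cases i; cases j) auto
    qed
    fix a r assume "(a, r) \<in> F"
    then obtain c s where cs: "(c, s) \<in> C" "cball (ctr (a, r)) (rad (a, r)) \<subseteq> ball (ctr (c, s)) (5 * rad (c, s))"
      using C(4) by (metis surj_pair)
    then have "0 < s" using F C(2) by blast
    then have "cube a r \<subseteq> interior (dilate (3 * n) c s)"
      using in_ball[of a r] in_dil[of s c] cs(2) by blast
    then show "\<exists>(c, s)\<in>C. cube a r \<subseteq> interior (dilate (3 * real CARD('n)) c s)"
      using cs(1) unfolding n_def by auto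
  qed
qed

text \<open>The factor by which the dilation of the covering lemma multiplies volumes.\<close>

definition vitali_factor :: "'n::finite itself \<Rightarrow> real" where
  "vitali_factor _ = (6 * real CARD('n) + 1) ^ CARD('n)"

lemma vitali_factor_ge1: "1 \<le> vitali_factor TYPE('n::finite)"
  unfolding vitali_factor_def by (rule one_le_power) simp

lemma emeasure_vitali_dilate:
  fixes c :: "real ^ 'n::finite"
  assumes "0 \<le> s"
  shows "emeasure lebesgue (dilate (3 * real CARD('n)) c s) = ennreal (vitali_factor TYPE('n)) * ennreal (s ^ CARD('n))"
proof -
  have "emeasure lebesgue (dilate (3 * real CARD('n)) c s) = ennreal (((2 * (3 * real CARD('n)) + 1) * s) ^ CARD('n))"
    unfolding dilate_def using assms by (intro emeasure_cube) simp
  also have "((2 * (3 * real CARD('n)) + 1) * s) ^ CARD('n) = vitali_factor TYPE('n) * s ^ CARD('n)"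
    by (simp add: vitali_factor_def power_mult_distrib)
  finally show ?thesis using assms vitali_factor_ge1[where 'n='n] by (simp add: ennreal_mult)
qed

text \<open>The shape in which the covering lemma serves all weak-type estimates below: each cube of the family carries
  density at least \<open>1 / \<kappa>\<close> of \<open>g\<close>, and each selected cube is charged with a set \<open>E\<close> that is a fraction \<open>\<eta>\<close> of
  its dilation (the dilation itself, or a smaller exceptional subset). Disjointness of the selected cubes
  bounds the total charge by the mass of \<open>g\<close>.\<close>

lemma Vitali_selection_bound:
  fixes F :: "((real ^ 'n::finite) \<times> real) set" and g :: "real ^ 'n \<Rightarrow> ennreal"
  assumes F: "\<And>a r. (a, r) \<in> F \<Longrightarrow> 0 < r \<and> r \<le> D \<and> cube a r \<subseteq> P"
    and P: "P \<in> sets lebesgue" and g: "g \<in> borel_measurable lebesgue"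
    and dens: "\<And>a r. (a, r) \<in> F \<Longrightarrow> ennreal (r ^ CARD('n)) \<le> \<kappa> * (\<integral>\<^sup>+y\<in>cube a r. g y \<partial>lebesgue)"
    and E: "\<And>c s. (c, s) \<in> F \<Longrightarrow> E (c, s) \<in> sets lebesgue \<and>
              emeasure lebesgue (E (c, s)) \<le> \<eta> * emeasure lebesgue (dilate (3 * real CARD('n)) c s)"
  obtains C where "C \<subseteq> F" "(\<Union>j\<in>C. E j) \<in> sets lebesgue"
    "emeasure lebesgue (\<Union>j\<in>C. E j) \<le> \<eta> * ennreal (vitali_factor TYPE('n)) * \<kappa> * (\<integral>\<^sup>+y\<in>P. g y \<partial>lebesgue)"
    "\<And>a r. (a, r) \<in> F \<Longrightarrow>
       \<exists>(c, s)\<in>C. cube a r \<subseteq> interior (dilate (3 * real CARD('n)) c s)"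
proof -
  obtain C where C: "countable C" "C \<subseteq> F" "disjoint_family_on (\<lambda>(c, s). cube c s) C"
    "\<And>a r. (a, r) \<in> F \<Longrightarrow> \<exists>(c, s)\<in>C. cube a r \<subseteq> interior (dilate (3 * real CARD('n)) c s)"
    using Vitali_cubes[of F D] F by metis
  define X where "X = (\<lambda>(c :: real ^ 'n, s). cube c s)"
  define K where "K = \<eta> * ennreal (vitali_factor TYPE('n)) * \<kappa>"
  define \<nu> where "\<nu> = density lebesgue g"
  have Xm: "X j \<in> sets lebesgue" for j by (auto simp: X_def split: prod.splits)
  have \<nu>: "emeasure \<nu> A = (\<integral>\<^sup>+y\<in>A. g y \<partial>lebesgue)" if "A \<in> sets lebesgue" for A
    unfolding \<nu>_def using that g by (simp add: emeasure_density)
  have Em: "E j \<in> sets lebesgue" if "j \<in> C" for j using E[of "fst j" "snd j"] C(2) that by auto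
  have Ej: "emeasure lebesgue (E j) \<le> K * emeasure \<nu> (X j)" if j: "j \<in> C" for j
  proof -
    obtain c s where cs: "j = (c, s)" by (cases j)
    have jF: "(c, s) \<in> F" using j C(2) cs by auto
    have "emeasure lebesgue (E j) \<le> \<eta> * (ennreal (vitali_factor TYPE('n)) * ennreal (s ^ CARD('n)))"
      using E[OF jF] F[OF jF] cs emeasure_vitali_dilate[of s c] by simp
    also have "\<dots> \<le> \<eta> * (ennreal (vitali_factor TYPE('n)) * (\<kappa> * (\<integral>\<^sup>+y\<in>cube c s. g y \<partial>lebesgue)))"
      by (intro mult_left_mono dens jF) auto
    also have "\<dots> = K * emeasure \<nu> (X j)" using \<nu>[OF Xm[of j]] by (simp add: K_def X_def cs mult.assoc)
    finally show ?thesis .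
  qed
  have "emeasure lebesgue (\<Union>j\<in>C. E j) \<le> (\<integral>\<^sup>+j. emeasure lebesgue (E j) \<partial>count_space C)"
  proof (cases "C = {}")
    case False
    show ?thesis
    proof (cases "finite C")
      case True
      then show ?thesis
        using emeasure_subadditive_finite[of C E lebesgue] Em
        by (simp add: nn_integral_count_space_finite image_subset_iff)
    next
      case False
      then have bij: "bij_betw (from_nat_into C) UNIV C" using C(1) by (simp add: bij_betw_from_nat_into)
      have un: "(\<Union>j\<in>C. E j) = (\<Union>i. E (from_nat_into C i))"
        using bij unfolding bij_betw_def by (metis image_image)
      have "emeasure lebesgue (\<Union>i. E (from_nat_into C i)) \<le> (\<Sum>i. emeasure lebesgue (E (from_nat_into C i)))"
        by (intro emeasure_subadditive_countably) (auto intro!: Em from_nat_into[OF \<open>C \<noteq> {}\<close>])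
      also have "\<dots> = (\<integral>\<^sup>+i. emeasure lebesgue (E (from_nat_into C i)) \<partial>count_space UNIV)"
        by (simp add: nn_integral_count_space_nat)
      also have "\<dots> = (\<integral>\<^sup>+j. emeasure lebesgue (E j) \<partial>count_space C)"
        by (rule nn_integral_bij_count_space[OF bij])
      finally show ?thesis using un by simp
    qed
  qed simp
  also have "\<dots> \<le> (\<integral>\<^sup>+j. K * emeasure \<nu> (X j) \<partial>count_space C)"
    by (intro nn_integral_mono) (simp add: Ej)
  also have "\<dots> = K * (\<integral>\<^sup>+j. emeasure \<nu> (X j) \<partial>count_space C)"
    by (simp add: nn_integral_cmult)
  also have "(\<integral>\<^sup>+j. emeasure \<nu> (X j) \<partial>count_space C) = emeasure \<nu> (\<Union>j\<in>C. X j)"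
    using C(1,3) Xm unfolding X_def[symmetric] by (intro emeasure_UN_countable[symmetric]) (auto simp: \<nu>_def)
  also have "\<dots> \<le> emeasure \<nu> P"
  proof (rule emeasure_mono)
    show "(\<Union>j\<in>C. X j) \<subseteq> P" using F C(2) unfolding X_def by fastforce
  qed (use P in \<open>simp add: \<nu>_def\<close>)
  also have "emeasure \<nu> P = (\<integral>\<^sup>+y\<in>P. g y \<partial>lebesgue)" by (rule \<nu>[OF P])
  finally have "emeasure lebesgue (\<Union>j\<in>C. E j) \<le> K * (\<integral>\<^sup>+y\<in>P. g y \<partial>lebesgue)"
    by (simp add: mult_left_mono)
  moreover have "(\<Union>j\<in>C. E j) \<in> sets lebesgue"
    using C(1) Em by (intro sets.countable_UN') auto
  ultimately show thesis using that[of C] C(2,4) unfolding K_def by blast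
qed


text \<open>A dilated cube may leave the ambient cube, where nothing is known about averages. Shifting it back inside
  costs nothing, since only the part inside the ambient cube has to be covered.\<close>

lemma clamped_dilate:
  fixes c p :: "real ^ 'n::finite"
  assumes s: "0 < s" and sub: "cube c s \<subseteq> cube p \<rho>"
  obtains t \<tau> where "0 < \<tau>" "cube t \<tau> \<subseteq> cube p \<rho>" "cube c s \<subseteq> cube t \<tau>"
    "cube p \<rho> \<inter> dilate (3 * real CARD('n)) c s \<subseteq> cube t \<tau>" "\<tau> \<le> (6 * real CARD('n) + 1) * s"
    "cube t \<tau> = cube p \<rho> \<or> 2 * s \<le> \<tau>"
proof (cases "\<rho> \<le> (6 * real CARD('n) + 1) * s")
  case True
  have "s \<le> \<rho>" using cube_subset_side[OF _ sub] s by simp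
  then show ?thesis using that[of \<rho> p] True s sub by auto
next
  case False
  define k where "k = 3 * real CARD('n)"
  have k: "k \<ge> 1" using zero_less_card_finite[where 'a='n] unfolding k_def by linarith
  define \<tau> where "\<tau> = (2 * k + 1) * s"
  have \<tau>: "\<tau> < \<rho>" using False by (simp add: \<tau>_def k_def)
  have ks: "k * s \<ge> s" using k s by simp
  define t :: "real ^ 'n" where "t = (\<chi> i. max (p $ i) (min (c $ i - k * s) (p $ i + \<rho> - \<tau>)))"
  have c: "p $ i \<le> c $ i" "c $ i + s \<le> p $ i + \<rho>" for i using sub s by (auto simp: cube_subset_iff)
  have \<tau>0: "\<tau> > 0" using s k by (simp add: \<tau>_def)
  have te: "\<tau> = 2 * (k * s) + s" by (simp add: \<tau>_def algebra_simps)
  show ?thesis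
  proof (rule that[of \<tau> t])
    show "0 < \<tau>" by fact
    show "cube t \<tau> \<subseteq> cube p \<rho>" using \<tau>0 \<tau> by (auto simp: cube_subset_iff t_def)
    show "cube c s \<subseteq> cube t \<tau>"
      unfolding cube_subset_iff[OF less_imp_le[OF s]]
    proof
      fix i show "t $ i \<le> c $ i \<and> c $ i + s \<le> t $ i + \<tau>"
        using c[of i] \<tau> te ks s unfolding t_def by (simp add: max_def min_def)
    qed
    show "cube p \<rho> \<inter> dilate (3 * real CARD('n)) c s \<subseteq> cube t \<tau>"
    proof
      fix x assume x: "x \<in> cube p \<rho> \<inter> dilate (3 * real CARD('n)) c s"
      show "x \<in> cube t \<tau>"
        unfolding mem_cube
      proof
        fix i
        have "p $ i \<le> x $ i" "x $ i \<le> p $ i + \<rho>" using x by (auto simp: mem_cube)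
        moreover have "c $ i - k * s \<le> x $ i" "x $ i \<le> c $ i + (k + 1) * s"
          using x by (auto simp: mem_dilate k_def)
        then have "x $ i \<le> (c $ i - k * s) + \<tau>" by (simp add: te algebra_simps)
        ultimately show "t $ i \<le> x $ i \<and> x $ i \<le> t $ i + \<tau>"
          using \<open>c $ i - k * s \<le> x $ i\<close> \<tau> unfolding t_def by (simp add: max_def min_def)
      qed
    qed
    show "\<tau> \<le> (6 * real CARD('n) + 1) * s" by (simp add: \<tau>_def k_def)
    show "cube t \<tau> = cube p \<rho> \<or> 2 * s \<le> \<tau>" using te ks s by linarith
  qed
qed

section \<open>Averages and Lebesgue points\<close>

lemma average_deviation:
  fixes b :: "real ^ 'n::finite \<Rightarrow> real"
  assumes r: "0 < r" and b: "set_integrable lebesgue (cube a r) b"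
  shows "ennreal (\<bar>average (cube a r) b - c\<bar> * r ^ CARD('n)) \<le> (\<integral>\<^sup>+y\<in>cube a r. ennreal \<bar>b y - c\<bar> \<partial>lebesgue)"
proof -
  let ?R = "cube a r"
  have c: "set_integrable lebesgue ?R (\<lambda>_. c)"
    unfolding set_integrable_def
    using r by (intro integrable_scaleR_left) (auto simp: integrable_indicator_iff emeasure_cube)
  have i: "set_integrable lebesgue ?R (\<lambda>y. b y - c)" using b c by (rule set_integral_diff)
  have "(LINT y:?R|lebesgue. b y - c) = (LINT y:?R|lebesgue. b y) - (LINT y:?R|lebesgue. c)"
    using b c by (rule set_integral_diff)
  also have "(LINT y:?R|lebesgue. c) = c * r ^ CARD('n)"
    using r unfolding set_lebesgue_integral_def
    by (subst integral_scaleR_left) (auto simp: integrable_indicator_iff measure_cube emeasure_cube)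
  also have "(LINT y:?R|lebesgue. b y) = average ?R b * r ^ CARD('n)"
    using r by (simp add: average_def measure_cube)
  finally have eq: "(LINT y:?R|lebesgue. b y - c) = (average ?R b - c) * r ^ CARD('n)"
    by (simp add: algebra_simps)
  have "ennreal (norm (LINT y:?R|lebesgue. b y - c)) \<le> (\<integral>\<^sup>+y. norm (indicator ?R y *\<^sub>R (b y - c)) \<partial>lebesgue)"
    using i unfolding set_lebesgue_integral_def set_integrable_def by (rule integral_norm_bound_ennreal)
  also have "\<dots> = (\<integral>\<^sup>+y\<in>?R. ennreal \<bar>b y - c\<bar> \<partial>lebesgue)"
    by (intro nn_integral_cong) (auto split: split_indicator)
  finally show ?thesis using eq r by (simp add: abs_mult)
qed

lemma locally_integrable_cube:
  "locally_integrable f \<Longrightarrow> set_integrable lebesgue (cube a r) f"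
  unfolding locally_integrable_def cube_def by (meson compact_cbox)

lemma mem_big_cube:
  fixes x :: "real ^ 'n::finite"
  obtains k0 :: nat where "\<And>k. k0 \<le> k \<Longrightarrow> x \<in> cube (\<chi> i. - real k) (2 * real k)"
proof -
  obtain k0 :: nat where "norm x \<le> real k0" using real_arch_simple by blast
  moreover have "\<bar>x $ i\<bar> \<le> norm x" for i by (rule component_le_norm_cart)
  ultimately have "x \<in> cube (\<chi> i. - real k) (2 * real k)" if "k0 \<le> k" for k
    unfolding mem_cube using that by (auto simp: abs_le_iff) (smt (verit) of_nat_le_iff)+
  then show thesis using that by blast
qed

lemma locally_integrable_measurable:
  fixes f :: "real ^ 'n::finite \<Rightarrow> real"
  assumes "\<And>a r. set_integrable lebesgue (cube a r) f"
  shows "f \<in> borel_measurable lebesgue"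
proof (rule borel_measurable_LIMSEQ_real)
  let ?g = "\<lambda>k :: nat. \<lambda>x. indicator (cube (\<chi> i. - real k) (2 * real k)) x *\<^sub>R f x"
  show "?g k \<in> borel_measurable lebesgue" for k
    using assms[of "\<chi> i. - real k" "2 * real k"] unfolding set_integrable_def by (rule borel_measurable_integrable)
  fix x :: "real ^ 'n"
  obtain k0 where "\<And>k. k0 \<le> k \<Longrightarrow> x \<in> cube (\<chi> i. - real k) (2 * real k)" using mem_big_cube by blast
  then have "eventually (\<lambda>k. ?g k x = f x) sequentially"
    unfolding eventually_sequentially by (intro exI[of _ k0]) simp
  then show "(\<lambda>k. ?g k x) \<longlonglongrightarrow> f x" by (rule tendsto_eventually)
qed

text \<open>Cubes with corner \<open>x\<close> suffice for differentiation, since every family of cubes below admits any cube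
  that contains \<open>x\<close>.\<close>

lemma Lebesgue_points_corner_cubes:
  fixes f :: "real ^ 'n::finite \<Rightarrow> real"
  assumes f: "\<And>a r. set_integrable lebesgue (cube a r) f"
  obtains N where "N \<in> null_sets lebesgue"
    "\<And>x e. x \<notin> N \<Longrightarrow> 0 < e \<Longrightarrow> \<exists>d>0. \<forall>h. 0 < h \<and> h < d \<longrightarrow> \<bar>average (cube x h) f - f x\<bar> < e"
proof -
  have "f integrable_on cbox a c" for a c
  proof -
    define r where "r = (\<Sum>i\<in>UNIV. \<bar>c $ i - a $ i\<bar>)"
    have "cbox a c \<subseteq> cube a r"
    proof
      fix x assume x: "x \<in> cbox a c"
      show "x \<in> cube a r"
        unfolding mem_cube
      proof
        fix i
        have "\<bar>c $ i - a $ i\<bar> \<le> r" unfolding r_def by (rule member_le_sum) auto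
        then show "a $ i \<le> x $ i \<and> x $ i \<le> a $ i + r" using x by (auto simp: mem_box_cart abs_le_iff) (smt (verit))
      qed
    qed
    then have "set_integrable lebesgue (cbox a c) f"
      using set_integrable_subset[OF f[of a r], of "cbox a c"] by simp
    then show ?thesis using set_lebesgue_integral_eq_integral(1) by blast
  qed
  then obtain N where N: "negligible N"
    "\<And>x e. \<lbrakk>x \<notin> N; 0 < e\<rbrakk> \<Longrightarrow> \<exists>d>0. \<forall>h. 0 < h \<and> h < d \<longrightarrow>
         norm (integral (cbox x (x + h *\<^sub>R One)) f /\<^sub>R h ^ DIM(real ^ 'n) - f x) < e"
    by (rule integrable_ccontinuous_explicit) (blast intro: that)+
  have "(One :: real ^ 'n) $ i = 1" for i
  proof -
    have "inner One (axis i 1 :: real ^ 'n) = 1" by (rule inner_sum_Basis) simp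
    then show ?thesis unfolding inner_axis by simp
  qed
  then have one: "One = (1 :: real ^ 'n)" by (simp add: vec_eq_iff del: sum_component)
  have "integral (cbox x (x + h *\<^sub>R One)) f /\<^sub>R h ^ DIM(real ^ 'n) = average (cube x h) f" if "0 < h" for x h
  proof -
    have "x + h *\<^sub>R One = (\<chi> i. x $ i + h)" unfolding one by (simp add: vec_eq_iff)
    then have "integral (cbox x (x + h *\<^sub>R One)) f = (LINT y:cube x h|lebesgue. f y)"
      using set_lebesgue_integral_eq_integral(2)[OF f[of x h]] by (simp add: cube_def)
    then show ?thesis using that by (simp add: average_def measure_cube divide_inverse mult.commute)
  qed
  then have "\<exists>d>0. \<forall>h. 0 < h \<and> h < d \<longrightarrow> \<bar>average (cube x h) f - f x\<bar> < e" if "x \<notin> N" "0 < e" for x e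
    using N(2)[OF that] by (metis real_norm_def)
  moreover have "N \<in> null_sets lebesgue" using N(1) by (simp add: negligible_iff_null_sets)
  ultimately show thesis using that by blast
qed

lemma mem_interior_cube: "x \<in> interior (cube p \<rho>) \<longleftrightarrow> (\<forall>i. p $ i < x $ i \<and> x $ i < p $ i + \<rho>)"
  by (simp add: cube_def interior_cbox mem_box_cart)

lemma corner_cube_subset:
  fixes x :: "real ^ 'n::finite"
  assumes "x \<in> interior (cube p \<rho>)"
  obtains d where "0 < d" "\<And>h. h \<le> d \<Longrightarrow> cube x h \<subseteq> cube p \<rho>"
proof -
  define d where "d = Min (range (\<lambda>i. p $ i + \<rho> - x $ i))"
  have "0 < d" using assms by (auto simp: d_def mem_interior_cube)
  moreover have "cube x h \<subseteq> cube p \<rho>" if "h \<le> d" for h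
  proof
    fix y assume y: "y \<in> cube x h"
    show "y \<in> cube p \<rho>"
      unfolding mem_cube
    proof
      fix i
      have "d \<le> p $ i + \<rho> - x $ i" unfolding d_def by (rule Min_le) auto
      moreover have "x $ i \<le> y $ i" "y $ i \<le> x $ i + h" using y by (auto simp: mem_cube)
      moreover have "p $ i < x $ i" using assms by (auto simp: mem_interior_cube)
      ultimately show "p $ i \<le> y $ i \<and> y $ i \<le> p $ i + \<rho>" using that by linarith
    qed
  qed
  ultimately show thesis using that by blast
qed

section \<open>The John-Nirenberg inequality for all subcubes\<close>

text \<open>The number \<open>\<Lambda>\<close> is the height of one step in the John-Nirenberg iteration, chosen so that the selected
  cubes, even after dilation, fill at most half of the ambient cube.\<close>

locale bounded_oscillation =
  fixes b :: "real ^ 'n::finite \<Rightarrow> real" and B \<Lambda> :: real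
  assumes B_pos: "0 < B"
    and \<Lambda>_def: "\<Lambda> = 2 * vitali_factor TYPE('n) * B"
    and b_int: "\<And>a r. set_integrable lebesgue (cube a r) b"
    and osc: "\<And>a r. 0 < r \<Longrightarrow>
      (\<integral>\<^sup>+y\<in>cube a r. ennreal \<bar>b y - average (cube a r) b\<bar> \<partial>lebesgue) \<le> ennreal (B * r ^ CARD('n))"
begin

abbreviation "av \<equiv> (\<lambda>a r. average (cube a r) b)"

lemma \<Lambda>_pos: "0 < \<Lambda>" 
  using B_pos vitali_factor_ge1[where 'n='n] by (simp add: \<Lambda>_def)

lemma b_measurable [measurable]: "b \<in> borel_measurable lebesgue"
  using b_int by (rule locally_integrable_measurable)

text \<open>Induction on the level \<open>m\<close>. Among the subcubes whose average is more than \<open>\<Lambda>\<close> away from that of \<open>P\<close>, keep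
  those that no such cube of at least twice the side contains. A Vitali selection picks disjoint ones, whose
  total volume is at most \<open>B |P| / \<Lambda>\<close>. By near maximality the clamped dilation \<open>T\<close> of a selected cube has an
  average within \<open>\<Lambda>\<close> of that of \<open>P\<close>, so a subcube more than \<open>(m + 1) \<Lambda>\<close> away from \<open>P\<close> is more than
  \<open>m \<Lambda>\<close> away from the \<open>T\<close> that contains it, and the induction hypothesis applies inside \<open>T\<close>. Covering
  whole subcubes, and not just points, is what makes the statement reproduce itself.\<close>

lemma John_Nirenberg_cubes:
  "0 < \<rho> \<Longrightarrow> \<exists>E\<in>sets lebesgue. emeasure lebesgue E \<le> ennreal ((1 / 2) ^ m * \<rho> ^ CARD('n)) \<and>
     (\<forall>a r. 0 < r \<and> cube a r \<subseteq> cube p \<rho> \<and> real m * \<Lambda> < \<bar>av a r - av p \<rho>\<bar> \<longrightarrow> cube a r \<subseteq> E)"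
proof (induction m arbitrary: p \<rho>)
  case 0
  then show ?case by (intro bexI[of _ "cube p \<rho>"]) (auto simp: emeasure_cube)
next
  case (Suc m)
  define big where "big = {(a, r). 0 < r \<and> cube a r \<subseteq> cube p \<rho> \<and> \<Lambda> < \<bar>av a r - av p \<rho>\<bar>}"
  define F where "F = {(a, r) \<in> big. \<forall>(a', r') \<in> big. cube a r \<subseteq> cube a' r' \<longrightarrow> r' < 2 * r}"
  have side: "r \<le> \<rho>" if "(a, r) \<in> big" for a r
    using that cube_subset_side[of r a p \<rho>] by (auto simp: big_def)
  have F_cover: "\<exists>(a', r')\<in>F. cube a r \<subseteq> cube a' r'" if ar: "(a, r) \<in> big" for a r
  proof -
    \<comment> \<open>A cube whose side exceeds half the supremum of the admissible sides is nearly maximal.\<close>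
    define S where "S = {r'. \<exists>a'. (a', r') \<in> big \<and> cube a r \<subseteq> cube a' r'}"
    have S: "r \<in> S" "bdd_above S" using ar side unfolding S_def by (auto intro!: bdd_aboveI[of _ \<rho>])
    have "0 < r" using ar by (simp add: big_def)
    moreover have "r \<le> Sup S" using S by (rule cSup_upper)
    ultimately have "Sup S / 2 < Sup S" by simp
    then obtain r' where r': "r' \<in> S" "Sup S / 2 < r'" using less_cSupD[of S] S(1) by blast
    then obtain a' where a': "(a', r') \<in> big" "cube a r \<subseteq> cube a' r'" unfolding S_def by blast
    have "r'' < 2 * r'" if "(a'', r'') \<in> big" "cube a' r' \<subseteq> cube a'' r''" for a'' r''
    proof -
      have "r'' \<in> S" unfolding S_def using that a'(2) by blast
      then have "r'' \<le> Sup S" using S(2) by (rule cSup_upper)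
      then show ?thesis using r'(2) by linarith
    qed
    then have "(a', r') \<in> F" unfolding F_def using a'(1) by auto
    then show ?thesis using a'(2) by blast
  qed
  have "\<forall>j. \<exists>T. j \<in> F \<longrightarrow> (case (j, T) of ((c, s), (t, \<tau>)) \<Rightarrow>
      0 < \<tau> \<and> cube t \<tau> \<subseteq> cube p \<rho> \<and> cube p \<rho> \<inter> dilate (3 * real CARD('n)) c s \<subseteq> cube t \<tau> \<and>
      \<tau> \<le> (6 * real CARD('n) + 1) * s \<and> \<bar>av t \<tau> - av p \<rho>\<bar> \<le> \<Lambda>)"
  proof (intro allI)
    fix j :: "(real ^ 'n) \<times> real"
    obtain c s where j: "j = (c, s)" by (cases j)
    show "\<exists>T. j \<in> F \<longrightarrow> (case (j, T) of ((c, s), (t, \<tau>)) \<Rightarrow>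
      0 < \<tau> \<and> cube t \<tau> \<subseteq> cube p \<rho> \<and> cube p \<rho> \<inter> dilate (3 * real CARD('n)) c s \<subseteq> cube t \<tau> \<and>
      \<tau> \<le> (6 * real CARD('n) + 1) * s \<and> \<bar>av t \<tau> - av p \<rho>\<bar> \<le> \<Lambda>)"
    proof (cases "j \<in> F")
      case True
      then have cs: "0 < s" "cube c s \<subseteq> cube p \<rho>" 
        and max: "\<And>a' r'. (a', r') \<in> big \<Longrightarrow> cube c s \<subseteq> cube a' r' \<Longrightarrow> r' < 2 * s"
        by (auto simp: F_def big_def j)
      obtain t \<tau> where t: "0 < \<tau>" "cube t \<tau> \<subseteq> cube p \<rho>" "cube c s \<subseteq> cube t \<tau>"
        "cube p \<rho> \<inter> dilate (3 * real CARD('n)) c s \<subseteq> cube t \<tau>" "\<tau> \<le> (6 * real CARD('n) + 1) * s"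
        "cube t \<tau> = cube p \<rho> \<or> 2 * s \<le> \<tau>"
        by (rule clamped_dilate[OF cs]) (rule that)
      have "\<bar>av t \<tau> - av p \<rho>\<bar> \<le> \<Lambda>"
        using t(6)
      proof
        assume "2 * s \<le> \<tau>"
        then have "(t, \<tau>) \<notin> big" using max[of t \<tau>] t(3) by auto
        then show ?thesis using t(1,2) by (simp add: big_def)
      qed (use \<Lambda>_pos in simp)
      then show ?thesis using t j by (intro exI[of _ "(t, \<tau>)"]) simp
    qed simp
  qed
  from choice[OF this] obtain T where T: "\<forall>j. j \<in> F \<longrightarrow> (case (j, T j) of ((c, s), (t, \<tau>)) \<Rightarrow>
      0 < \<tau> \<and> cube t \<tau> \<subseteq> cube p \<rho> \<and> cube p \<rho> \<inter> dilate (3 * real CARD('n)) c s \<subseteq> cube t \<tau> \<and>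
      \<tau> \<le> (6 * real CARD('n) + 1) * s \<and> \<bar>av t \<tau> - av p \<rho>\<bar> \<le> \<Lambda>)"
    by (rule exE)
  define ta where "ta j = fst (T j)" for j
  define tr where "tr j = snd (T j)" for j
  have T: "0 < tr (c, s)" "cube (ta (c, s)) (tr (c, s)) \<subseteq> cube p \<rho>"
      "cube p \<rho> \<inter> dilate (3 * real CARD('n)) c s \<subseteq> cube (ta (c, s)) (tr (c, s))"
      "tr (c, s) \<le> (6 * real CARD('n) + 1) * s" "\<bar>av (ta (c, s)) (tr (c, s)) - av p \<rho>\<bar> \<le> \<Lambda>"
    if "(c, s) \<in> F" for c s
    using T[rule_format, OF that] unfolding ta_def tr_def by (simp_all add: case_prod_beta)
  have "\<forall>j. \<exists>E. j \<in> F \<longrightarrow> E \<in> sets lebesgue \<and> emeasure lebesgue E \<le> ennreal ((1 / 2) ^ m * tr j ^ CARD('n)) \<and>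
     (\<forall>a r. 0 < r \<and> cube a r \<subseteq> cube (ta j) (tr j) \<and> real m * \<Lambda> < \<bar>av a r - av (ta j) (tr j)\<bar> \<longrightarrow> cube a r \<subseteq> E)"
    using Suc.IH T(1) by (metis surj_pair)
  from choice[OF this] obtain E where
    E: "\<And>j. j \<in> F \<Longrightarrow> E j \<in> sets lebesgue \<and> emeasure lebesgue (E j) \<le> ennreal ((1 / 2) ^ m * tr j ^ CARD('n))"
    and E_sub: "\<And>j a r. j \<in> F \<Longrightarrow> 0 < r \<Longrightarrow> cube a r \<subseteq> cube (ta j) (tr j) \<Longrightarrow>
        real m * \<Lambda> < \<bar>av a r - av (ta j) (tr j)\<bar> \<Longrightarrow> cube a r \<subseteq> E j" by blast
  obtain C where C: "C \<subseteq> F" "(\<Union>j\<in>C. E j) \<in> sets lebesgue"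
    "emeasure lebesgue (\<Union>j\<in>C. E j) \<le> ennreal ((1 / 2) ^ m) * ennreal (vitali_factor TYPE('n)) * ennreal (1 / \<Lambda>) *
       (\<integral>\<^sup>+y\<in>cube p \<rho>. ennreal \<bar>b y - av p \<rho>\<bar> \<partial>lebesgue)"
    "\<And>a r. (a, r) \<in> F \<Longrightarrow> \<exists>(c, s)\<in>C. cube a r \<subseteq> interior (dilate (3 * real CARD('n)) c s)"
  proof (rule Vitali_selection_bound[where F=F and D=\<rho> and P="cube p \<rho>" and E=E and \<eta>="ennreal ((1 / 2) ^ m)"
        and \<kappa>="ennreal (1 / \<Lambda>)" and g="\<lambda>y. ennreal \<bar>b y - av p \<rho>\<bar>"])
    fix a r assume ar: "(a, r) \<in> F"
    then have bar: "(a, r) \<in> big" by (auto simp: F_def)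
    then show "0 < r \<and> r \<le> \<rho> \<and> cube a r \<subseteq> cube p \<rho>" using side by (auto simp: big_def)
    have r: "0 < r" "\<Lambda> < \<bar>av a r - av p \<rho>\<bar>" using bar by (auto simp: big_def)
    have "ennreal (r ^ CARD('n)) = ennreal (1 / \<Lambda>) * ennreal (\<Lambda> * r ^ CARD('n))"
      using \<Lambda>_pos r(1) by (subst ennreal_mult[symmetric]) auto
    also have "\<dots> \<le> ennreal (1 / \<Lambda>) * ennreal (\<bar>av a r - av p \<rho>\<bar> * r ^ CARD('n))"
      using r by (intro mult_left_mono ennreal_leI mult_right_mono) auto
    also have "\<dots> \<le> ennreal (1 / \<Lambda>) * (\<integral>\<^sup>+y\<in>cube a r. ennreal \<bar>b y - av p \<rho>\<bar> \<partial>lebesgue)"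
      by (intro mult_left_mono average_deviation r b_int) auto
    finally show "ennreal (r ^ CARD('n)) \<le> ennreal (1 / \<Lambda>) * (\<integral>\<^sup>+y\<in>cube a r. ennreal \<bar>b y - av p \<rho>\<bar> \<partial>lebesgue)" .
  next
    fix c s assume cs: "(c, s) \<in> F"
    then have s: "0 < s" by (auto simp: F_def big_def)
    have "emeasure lebesgue (E (c, s)) \<le> ennreal ((1 / 2) ^ m * tr (c, s) ^ CARD('n))" using E[OF cs] by blast
    also have "\<dots> \<le> ennreal ((1 / 2) ^ m * ((6 * real CARD('n) + 1) * s) ^ CARD('n))"
      using T(1,4)[OF cs] by (intro ennreal_leI mult_left_mono power_mono) auto
    also have "\<dots> = ennreal ((1 / 2) ^ m) * emeasure lebesgue (dilate (3 * real CARD('n)) c s)"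
      using s vitali_factor_ge1[where 'n='n] by (subst emeasure_vitali_dilate) (auto simp: vitali_factor_def ennreal_mult power_mult_distrib)
    finally show "E (c, s) \<in> sets lebesgue \<and>
        emeasure lebesgue (E (c, s)) \<le> ennreal ((1 / 2) ^ m) * emeasure lebesgue (dilate (3 * real CARD('n)) c s)"
      using E[OF cs] by blast
  qed (auto intro: that)
  have "emeasure lebesgue (\<Union>j\<in>C. E j) \<le> ennreal ((1 / 2) ^ m) * ennreal (vitali_factor TYPE('n)) * ennreal (1 / \<Lambda>) * ennreal (B * \<rho> ^ CARD('n))"
    using C(3) osc[OF Suc.prems, of p] by (meson mult_left_mono order_trans zero_le)
  also have "\<dots> = ennreal ((1 / 2) ^ m * vitali_factor TYPE('n) * (1 / \<Lambda>) * (B * \<rho> ^ CARD('n)))"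
    using B_pos \<Lambda>_pos Suc.prems vitali_factor_ge1[where 'n='n] by (simp add: ennreal_mult[symmetric])
  also have "(1 / 2) ^ m * vitali_factor TYPE('n) * (1 / \<Lambda>) * (B * \<rho> ^ CARD('n)) = (1 / 2) ^ Suc m * \<rho> ^ CARD('n)"
    using B_pos vitali_factor_ge1[where 'n='n] by (simp add: \<Lambda>_def field_simps)
  finally have "emeasure lebesgue (\<Union>j\<in>C. E j) \<le> ennreal ((1 / 2) ^ Suc m * \<rho> ^ CARD('n))" .
  moreover have "cube a r \<subseteq> (\<Union>j\<in>C. E j)"
    if r: "0 < r" and sub: "cube a r \<subseteq> cube p \<rho>" and far: "real (Suc m) * \<Lambda> < \<bar>av a r - av p \<rho>\<bar>" for a r
  proof -
    have "\<Lambda> \<le> real (Suc m) * \<Lambda>" using \<Lambda>_pos by (simp add: algebra_simps)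
    then have "(a, r) \<in> big" using r sub far by (simp add: big_def)
    then obtain a' r' where a': "(a', r') \<in> F" "cube a r \<subseteq> cube a' r'" using F_cover by blast
    then obtain c s where cs: "(c, s) \<in> C" "cube a' r' \<subseteq> interior (dilate (3 * real CARD('n)) c s)" using C(4) by blast
    have csF: "(c, s) \<in> F" using cs(1) C(1) by blast
    have "cube a r \<subseteq> cube (ta (c, s)) (tr (c, s))"
      using T(3)[OF csF] sub a'(2) cs(2) interior_subset by blast
    moreover have "real m * \<Lambda> < \<bar>av a r - av (ta (c, s)) (tr (c, s))\<bar>"
      using T(5)[OF csF] far by (simp add: algebra_simps)
    ultimately show ?thesis using E_sub[OF csF r] cs(1) by blast
  qed
  ultimately show ?case using C(2) by (intro bexI[of _ "\<Union>j\<in>C. E j"]) auto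
qed

end

section \<open>The Zygmund function and Young's inequality\<close>

definition Phi :: "real \<Rightarrow> real" where
  "Phi v = v * (1 + logplus v)"

lemma logplus_nonneg: "0 \<le> logplus v"
  by (simp add: logplus_def)

lemma logplus_mono: "0 \<le> u \<Longrightarrow> u \<le> v \<Longrightarrow> logplus u \<le> logplus v"
  by (cases "u = 0") (auto simp: logplus_def max_def)

lemma Phi_mono: "0 \<le> u \<Longrightarrow> u \<le> v \<Longrightarrow> Phi u \<le> Phi v"
  unfolding Phi_def by (intro mult_mono) (auto simp: logplus_mono logplus_nonneg add_nonneg_nonneg)

lemma Phi_ge: "0 \<le> v \<Longrightarrow> v \<le> Phi v"
  using mult_left_mono[of 1 "1 + logplus v" v] by (simp add: Phi_def logplus_nonneg)

lemma Phi_measurable [measurable]: "Phi \<in> borel_measurable borel"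
  unfolding Phi_def logplus_def by measurable

text \<open>The convex conjugate of \<open>exp\<close> is \<open>v ln v - v\<close>, which lies below \<open>Phi\<close>.\<close>

lemma Young_exp:
  assumes "0 \<le> v"
  shows "u * v \<le> exp u + Phi v"
proof (cases "v = 0")
  case False
  then have v: "0 < v" using assms by simp
  have "v * (1 + (u - ln v)) \<le> v * exp (u - ln v)"
    using v by (intro mult_left_mono) auto
  also have "\<dots> = exp u" using v by (simp add: exp_diff)
  finally have "u * v \<le> exp u + v * ln v" using v by (simp add: algebra_simps)
  also have "v * ln v \<le> Phi v"
    unfolding Phi_def using v by (intro mult_left_mono) (auto simp: logplus_def)
  finally show ?thesis by simp
qed (simp add: Phi_def)

lemma interior_cube_null: "cube p \<rho> - interior (cube p \<rho>) \<in> null_sets lebesgue"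
  using negligible_frontier_interval[of p "\<chi> i. p $ i + \<rho>"]
  by (simp add: cube_def negligible_iff_null_sets)

lemma level_exists:
  assumes "0 < L" "0 < u"
  obtains m :: nat where "real m * L < u" "u \<le> (real m + 1) * L"
proof -
  define m where "m = nat (\<lceil>u / L\<rceil> - 1)"
  have "0 < u / L" using assms by simp
  then have "1 \<le> \<lceil>u / L\<rceil>" by (simp add: le_ceiling_iff)
  then have m: "real m = of_int \<lceil>u / L\<rceil> - 1" by (simp add: m_def of_nat_nat)
  have "real m < u / L" "u / L \<le> real m + 1" unfolding m by linarith+
  then show thesis using that[of m] assms(1) by (simp add: field_simps)
qed

lemma ennreal_term_le_suminf:
  fixes F :: "nat \<Rightarrow> ennreal"
  shows "F m \<le> (\<Sum>m. F m)"
  using sum_le_suminf[of F "{m}"] by simp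

section \<open>Consequences of exponential decay\<close>

context bounded_oscillation
begin

text \<open>A function of the cube and the level is needed, because the covering lemma charges such a set to every
  selected cube.\<close>

definition exceptional :: "real ^ 'n \<Rightarrow> real \<Rightarrow> nat \<Rightarrow> (real ^ 'n) set" where
  "exceptional p \<rho> m = (SOME E. E \<in> sets lebesgue \<and> emeasure lebesgue E \<le> ennreal ((1 / 2) ^ m * \<rho> ^ CARD('n)) \<and>
     (\<forall>a r. 0 < r \<and> cube a r \<subseteq> cube p \<rho> \<and> real m * \<Lambda> < \<bar>av a r - av p \<rho>\<bar> \<longrightarrow> cube a r \<subseteq> E))"

lemma exceptional:
  assumes "0 < \<rho>"
  shows "exceptional p \<rho> m \<in> sets lebesgue"
    and "emeasure lebesgue (exceptional p \<rho> m) \<le> ennreal ((1 / 2) ^ m * \<rho> ^ CARD('n))"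
    and "\<And>a r. 0 < r \<Longrightarrow> cube a r \<subseteq> cube p \<rho> \<Longrightarrow> real m * \<Lambda> < \<bar>av a r - av p \<rho>\<bar> \<Longrightarrow> cube a r \<subseteq> exceptional p \<rho> m"
proof -
  have "\<exists>E. E \<in> sets lebesgue \<and> emeasure lebesgue E \<le> ennreal ((1 / 2) ^ m * \<rho> ^ CARD('n)) \<and>
     (\<forall>a r. 0 < r \<and> cube a r \<subseteq> cube p \<rho> \<and> real m * \<Lambda> < \<bar>av a r - av p \<rho>\<bar> \<longrightarrow> cube a r \<subseteq> E)"
    using John_Nirenberg_cubes[OF assms, of m p] by blast
  from someI_ex[OF this] show "exceptional p \<rho> m \<in> sets lebesgue"
    "emeasure lebesgue (exceptional p \<rho> m) \<le> ennreal ((1 / 2) ^ m * \<rho> ^ CARD('n))"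
    "\<And>a r. 0 < r \<Longrightarrow> cube a r \<subseteq> cube p \<rho> \<Longrightarrow> real m * \<Lambda> < \<bar>av a r - av p \<rho>\<bar> \<Longrightarrow> cube a r \<subseteq> exceptional p \<rho> m"
    unfolding exceptional_def[symmetric] by blast+
qed

text \<open>At a Lebesgue point the value of \<open>b\<close> is a limit of averages over small corner cubes, which lie inside \<open>P\<close>
  because the point is interior. The null set does not depend on the cube.\<close>

lemma exceptional_at_Lebesgue_points:
  obtains N where "N \<in> null_sets lebesgue"
    "\<And>x p \<rho> m. x \<notin> N \<Longrightarrow> 0 < \<rho> \<Longrightarrow> x \<in> interior (cube p \<rho>) \<Longrightarrow> real m * \<Lambda> < \<bar>b x - av p \<rho>\<bar> \<Longrightarrow>
       x \<in> exceptional p \<rho> m"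
proof -
  obtain N where N: "N \<in> null_sets lebesgue"
    "\<And>x e. x \<notin> N \<Longrightarrow> 0 < e \<Longrightarrow> \<exists>d>0. \<forall>h. 0 < h \<and> h < d \<longrightarrow> \<bar>av x h - b x\<bar> < e"
    by (rule Lebesgue_points_corner_cubes[OF b_int]) (rule that)
  have "x \<in> exceptional p \<rho> m" if x: "x \<notin> N" "x \<in> interior (cube p \<rho>)" and \<rho>: "0 < \<rho>"
    and far: "real m * \<Lambda> < \<bar>b x - av p \<rho>\<bar>" for x p \<rho> m
  proof -
    obtain d where d: "0 < d" "\<And>h. 0 < h \<Longrightarrow> h < d \<Longrightarrow> \<bar>av x h - b x\<bar> < \<bar>b x - av p \<rho>\<bar> - real m * \<Lambda>"
      using N(2)[OF x(1), of "\<bar>b x - av p \<rho>\<bar> - real m * \<Lambda>"] far by auto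
    obtain d' where d': "0 < d'" "\<And>h. h \<le> d' \<Longrightarrow> cube x h \<subseteq> cube p \<rho>"
      using corner_cube_subset[OF x(2)] by blast
    define h where "h = min d d' / 2"
    have h: "0 < h" "h < d" "h \<le> d'" using d(1) d'(1) by (auto simp: h_def)
    have "real m * \<Lambda> < \<bar>av x h - av p \<rho>\<bar>" using d(2)[OF h(1,2)] by linarith
    then have "cube x h \<subseteq> exceptional p \<rho> m" using exceptional(3)[OF \<rho> h(1) d'(2)[OF h(3)]] by blast
    moreover have "x \<in> cube x h" using h(1) by (simp add: mem_cube)
    ultimately show ?thesis by blast
  qed
  then show thesis using that N(1) by blast
qed

text \<open>On the layer where the oscillation is between \<open>m \<Lambda>\<close> and \<open>(m + 1) \<Lambda>\<close> the integrand is at most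
  \<open>exp (1/2)\<close> to the power \<open>m + 1\<close>, against a measure \<open>2\<^sup>-\<^sup>m |P|\<close>. As \<open>exp (1/2) \<le> 7/4 < 2\<close> the series
  converges, with sum \<open>14 |P|\<close>; the points of zero oscillation contribute at most another \<open>|P|\<close>.\<close>

lemma exp_integrable:
  assumes \<rho>: "0 < \<rho>"
  shows "(\<integral>\<^sup>+y\<in>cube p \<rho>. ennreal (exp (\<bar>b y - av p \<rho>\<bar> / (2 * \<Lambda>))) \<partial>lebesgue) \<le> ennreal (15 * \<rho> ^ CARD('n))"
proof -
  obtain N where N: "N \<in> null_sets lebesgue"
    "\<And>x p \<rho> m. x \<notin> N \<Longrightarrow> 0 < \<rho> \<Longrightarrow> x \<in> interior (cube p \<rho>) \<Longrightarrow> real m * \<Lambda> < \<bar>b x - av p \<rho>\<bar> \<Longrightarrow>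
       x \<in> exceptional p \<rho> m"
    by (rule exceptional_at_Lebesgue_points) (rule that)
  let ?P = "cube p \<rho>"
  let ?t = "\<lambda>m y. ennreal ((7 / 4) ^ Suc m) * indicator (exceptional p \<rho> m) y"
  have half: "exp (1 / 2 :: real) \<le> 7 / 4"
  proof (rule power2_le_imp_le)
    have "(exp (1 / 2 :: real))\<^sup>2 = exp 1" by (simp add: exp_double[symmetric])
    also have "\<dots> \<le> 3" by (rule exp_le)
    finally show "(exp (1 / 2 :: real))\<^sup>2 \<le> (7 / 4)\<^sup>2" by (simp add: power2_eq_square)
  qed simp
  have ptw: "ennreal (exp (\<bar>b y - av p \<rho>\<bar> / (2 * \<Lambda>))) * indicator ?P y \<le> indicator ?P y + (\<Sum>m. ?t m y)"
    if y: "y \<notin> N" "y \<notin> ?P - interior ?P" for y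
  proof (cases "y \<in> ?P \<and> b y \<noteq> av p \<rho>")
    case True
    then have "0 < \<bar>b y - av p \<rho>\<bar>" by simp
    then obtain m where m: "real m * \<Lambda> < \<bar>b y - av p \<rho>\<bar>" "\<bar>b y - av p \<rho>\<bar> \<le> (real m + 1) * \<Lambda>"
      using level_exists[OF \<Lambda>_pos] by blast
    have ye: "y \<in> exceptional p \<rho> m" using N(2)[OF y(1) \<rho> _ m(1)] True y(2) by blast
    have "exp (\<bar>b y - av p \<rho>\<bar> / (2 * \<Lambda>)) \<le> exp (real (Suc m) * (1 / 2))"
      using m(2) \<Lambda>_pos by (simp add: field_simps)
    also have "\<dots> = exp (1 / 2) ^ Suc m" by (rule exp_of_nat_mult)
    also have "\<dots> \<le> (7 / 4) ^ Suc m" by (intro power_mono half) simp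
    finally have "ennreal (exp (\<bar>b y - av p \<rho>\<bar> / (2 * \<Lambda>))) \<le> ?t m y" using ye by (simp add: ennreal_leI)
    also have "\<dots> \<le> (\<Sum>m. ?t m y)"
      by (rule ennreal_term_le_suminf[of "\<lambda>m. ?t m y"])
    also have "\<dots> \<le> indicator ?P y + (\<Sum>m. ?t m y)" by simp
    finally show ?thesis using True by simp
  next
    case False
    then have "ennreal (exp (\<bar>b y - av p \<rho>\<bar> / (2 * \<Lambda>))) * indicator ?P y \<le> indicator ?P y"
      by (auto split: split_indicator)
    then show ?thesis by (rule order_trans) simp
  qed
  have [measurable]: "exceptional p \<rho> m \<in> sets lebesgue" for m using exceptional(1)[OF \<rho>] .
  have "AE y in lebesgue. ennreal (exp (\<bar>b y - av p \<rho>\<bar> / (2 * \<Lambda>))) * indicator ?P y \<le> indicator ?P y + (\<Sum>m. ?t m y)"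
    using AE_not_in[OF N(1)] AE_not_in[OF interior_cube_null[of p \<rho>]] by eventually_elim (rule ptw)
  then have "(\<integral>\<^sup>+y\<in>?P. ennreal (exp (\<bar>b y - av p \<rho>\<bar> / (2 * \<Lambda>))) \<partial>lebesgue) \<le> (\<integral>\<^sup>+y. indicator ?P y + (\<Sum>m. ?t m y) \<partial>lebesgue)"
    by (rule nn_integral_mono_AE)
  also have "\<dots> = emeasure lebesgue ?P + (\<Sum>m. ennreal ((7 / 4) ^ Suc m) * emeasure lebesgue (exceptional p \<rho> m))"
    by (subst nn_integral_add) (auto simp: nn_integral_suminf nn_integral_cmult)
  also have "\<dots> \<le> ennreal (\<rho> ^ CARD('n)) + (\<Sum>m. ennreal ((7 / 4) ^ Suc m) * ennreal ((1 / 2) ^ m * \<rho> ^ CARD('n)))"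
    using \<rho> by (intro add_mono suminf_le mult_left_mono exceptional(2)) (auto simp: emeasure_cube)
  also have "(\<Sum>m. ennreal ((7 / 4) ^ Suc m) * ennreal ((1 / 2) ^ m * \<rho> ^ CARD('n))) = ennreal (14 * \<rho> ^ CARD('n))"
  proof -
    have sums: "(\<lambda>m. (7 / 4 * \<rho> ^ CARD('n)) * (7 / 8) ^ m) sums ((7 / 4 * \<rho> ^ CARD('n)) * (1 / (1 - 7 / 8)))"
      by (intro sums_mult geometric_sums) simp
    have eq: "(7 / 4 * \<rho> ^ CARD('n)) * (7 / 8) ^ m = (7 / 4) ^ Suc m * ((1 / 2) ^ m * \<rho> ^ CARD('n))" for m
      using power_mult_distrib[of "7/4" "1/2 :: real" m] by simp
    have "(\<lambda>m. (7 / 4) ^ Suc m * ((1 / 2) ^ m * \<rho> ^ CARD('n))) sums (14 * \<rho> ^ CARD('n))"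
      using sums unfolding eq by simp
    then have "(\<Sum>m. ennreal ((7 / 4) ^ Suc m * ((1 / 2) ^ m * \<rho> ^ CARD('n)))) = ennreal (14 * \<rho> ^ CARD('n))"
      using \<rho> by (intro suminf_ennreal_eq) auto
    moreover have "ennreal ((7 / 4) ^ Suc m) * ennreal ((1 / 2) ^ m * \<rho> ^ CARD('n)) =
        ennreal ((7 / 4) ^ Suc m * ((1 / 2) ^ m * \<rho> ^ CARD('n)))" for m
      using \<rho> by (intro ennreal_mult[symmetric]) auto
    ultimately show ?thesis by (simp only:)
  qed
  also have "ennreal (\<rho> ^ CARD('n)) + ennreal (14 * \<rho> ^ CARD('n)) = ennreal (15 * \<rho> ^ CARD('n))"
    using \<rho> by (simp add: ennreal_plus[symmetric] del: ennreal_plus)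
  finally show ?thesis .
qed

text \<open>The generalized Hoelder inequality between BMO and \<open>L log L\<close>, with a free scale \<open>\<sigma>\<close> for \<open>f\<close>.\<close>

lemma oscillation_pairing:
  assumes \<rho>: "0 < \<rho>" and \<sigma>: "0 < \<sigma>" and f [measurable]: "f \<in> borel_measurable lebesgue"
  shows "(\<integral>\<^sup>+y\<in>cube p \<rho>. ennreal (\<bar>b y - av p \<rho>\<bar> * \<bar>f y\<bar>) \<partial>lebesgue)
    \<le> ennreal (2 * \<Lambda> * \<sigma>) * (ennreal (15 * \<rho> ^ CARD('n)) + (\<integral>\<^sup>+y\<in>cube p \<rho>. ennreal (Phi (\<bar>f y\<bar> / \<sigma>)) \<partial>lebesgue))"
proof -
  let ?P = "cube p \<rho>"
  let ?e = "\<lambda>y. ennreal (exp (\<bar>b y - av p \<rho>\<bar> / (2 * \<Lambda>)))"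
  let ?f = "\<lambda>y. ennreal (Phi (\<bar>f y\<bar> / \<sigma>))"
  have ptw: "ennreal (\<bar>b y - av p \<rho>\<bar> * \<bar>f y\<bar>) \<le> ennreal (2 * \<Lambda> * \<sigma>) * (?e y + ?f y)" for y
  proof -
    have nn: "0 \<le> Phi (\<bar>f y\<bar> / \<sigma>)" using Phi_ge[of "\<bar>f y\<bar> / \<sigma>"] \<sigma> by (smt (verit) divide_nonneg_pos)
    have "\<bar>b y - av p \<rho>\<bar> * \<bar>f y\<bar> = (2 * \<Lambda> * \<sigma>) * (\<bar>b y - av p \<rho>\<bar> / (2 * \<Lambda>) * (\<bar>f y\<bar> / \<sigma>))"
      using \<Lambda>_pos \<sigma> by simp
    also have "\<dots> \<le> (2 * \<Lambda> * \<sigma>) * (exp (\<bar>b y - av p \<rho>\<bar> / (2 * \<Lambda>)) + Phi (\<bar>f y\<bar> / \<sigma>))"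
      using \<Lambda>_pos \<sigma> by (intro mult_left_mono Young_exp) auto
    finally show ?thesis
      using nn \<Lambda>_pos \<sigma> by (simp add: ennreal_mult[symmetric] ennreal_plus[symmetric] ennreal_leI del: ennreal_plus)
  qed
  have "(\<integral>\<^sup>+y\<in>?P. ennreal (\<bar>b y - av p \<rho>\<bar> * \<bar>f y\<bar>) \<partial>lebesgue)
      \<le> (\<integral>\<^sup>+y. ennreal (2 * \<Lambda> * \<sigma>) * (?e y * indicator ?P y + ?f y * indicator ?P y) \<partial>lebesgue)"
    using ptw by (intro nn_integral_mono) (auto split: split_indicator)
  also have "\<dots> = ennreal (2 * \<Lambda> * \<sigma>) * ((\<integral>\<^sup>+y\<in>?P. ?e y \<partial>lebesgue) + (\<integral>\<^sup>+y\<in>?P. ?f y \<partial>lebesgue))"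
    by (subst nn_integral_cmult) (auto simp: nn_integral_add)
  also have "\<dots> \<le> ennreal (2 * \<Lambda> * \<sigma>) * (ennreal (15 * \<rho> ^ CARD('n)) + (\<integral>\<^sup>+y\<in>?P. ?f y \<partial>lebesgue))"
    by (intro mult_left_mono add_right_mono exp_integrable \<rho>) auto
  finally show ?thesis .
qed

text \<open>If the averages differ by more than \<open>m \<Lambda>\<close>, the whole small cube is exceptional in the large one, so its
  relative volume is at most \<open>2\<^sup>-\<^sup>m\<close>; take logarithms.\<close>

lemma average_log_growth:
  assumes r: "0 < r" and sub: "cube a r \<subseteq> cube p \<rho>"
  shows "\<bar>av a r - av p \<rho>\<bar> \<le> \<Lambda> * (1 + real CARD('n) * ln (\<rho> / r) / ln 2)"
proof -
  have r\<rho>: "r \<le> \<rho>" using cube_subset_side[OF _ sub] r by simp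
  have \<rho>: "0 < \<rho>" using r r\<rho> by simp
  have ln_nn: "0 \<le> ln (\<rho> / r)" using r r\<rho> by simp
  show ?thesis
  proof (cases "av a r = av p \<rho>")
    case True
    then show ?thesis using ln_nn \<Lambda>_pos by simp
  next
    case False
    then have "0 < \<bar>av a r - av p \<rho>\<bar>" by simp
    then obtain m where m: "real m * \<Lambda> < \<bar>av a r - av p \<rho>\<bar>" "\<bar>av a r - av p \<rho>\<bar> \<le> (real m + 1) * \<Lambda>"
      using level_exists[OF \<Lambda>_pos] by blast
    have "emeasure lebesgue (cube a r) \<le> emeasure lebesgue (exceptional p \<rho> m)"
      using exceptional(3)[OF \<rho> r sub m(1)] exceptional(1)[OF \<rho>] by (rule emeasure_mono)
    also have "\<dots> \<le> ennreal ((1 / 2) ^ m * \<rho> ^ CARD('n))" by (rule exceptional(2)[OF \<rho>])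
    finally have "r ^ CARD('n) \<le> (1 / 2) ^ m * \<rho> ^ CARD('n)"
      using r \<rho> by (simp add: emeasure_cube)
    then have "2 ^ m \<le> (\<rho> / r) ^ CARD('n)" using r by (simp add: field_simps power_divide)
    then have "ln (2 ^ m) \<le> ln ((\<rho> / r) ^ CARD('n))" using r \<rho> by (subst ln_le_cancel_iff) auto
    then have "real m * ln 2 \<le> real CARD('n) * ln (\<rho> / r)" using r \<rho> by (simp add: ln_realpow)
    then have "real m + 1 \<le> 1 + real CARD('n) * ln (\<rho> / r) / ln 2" by (simp add: field_simps)
    then show ?thesis using m(2) \<Lambda>_pos by (smt (verit) mult.commute mult_left_mono)
  qed
qed

end

section \<open>Functions in a Zygmund-Morrey space\<close>

lemma Phi_nonneg: "0 \<le> v \<Longrightarrow> 0 \<le> Phi v"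
  using Phi_ge[of v] by linarith

lemma Phi_contract:
  assumes "0 \<le> \<theta>" "\<theta> \<le> 1" "0 \<le> v"
  shows "Phi (\<theta> * v) \<le> \<theta> * Phi v"
proof -
  have "logplus (\<theta> * v) \<le> logplus v"
    using assms by (intro logplus_mono) (auto simp: mult_left_le_one_le)
  then have "\<theta> * v * (1 + logplus (\<theta> * v)) \<le> \<theta> * v * (1 + logplus v)"
    using assms by (intro mult_left_mono) auto
  then show ?thesis by (simp add: Phi_def mult.assoc)
qed

lemma dilate_mono: "0 \<le> r \<Longrightarrow> 0 \<le> k \<Longrightarrow> cube a r \<subseteq> dilate k a r"
  unfolding dilate_def by (simp add: cube_subset_iff algebra_simps)

lemma dilate_measurable [measurable, simp]: "dilate k a r \<in> sets lebesgue"
  by (simp add: dilate_def)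

lemma emeasure_dilate1:
  fixes a :: "real ^ 'n::finite"
  assumes "0 \<le> q"
  shows "emeasure lebesgue (dilate 1 a q) = ennreal (3 ^ CARD('n) * q ^ CARD('n))"
  unfolding dilate_def using assms by (simp add: emeasure_cube power_mult_distrib)

text \<open>The number \<open>N r\<^bsup>-\<lambda>\<^esup>\<close>, called \<open>height\<close> below, bounds the \<open>L log L\<close> norm of \<open>f\<close> over any cube of side
  \<open>r\<close>: this is what a bound \<open>N\<close> for the Zygmund-Morrey norm says.\<close>

locale zygmund_morrey_function =
  fixes f :: "real ^ 'n::finite \<Rightarrow> real" and lam N :: real
  assumes f_measurable [measurable]: "f \<in> borel_measurable lebesgue"
    and lam_pos: "0 < lam" and N_pos: "0 < N"
    and Phi_mass: "\<And>a r. 0 < r \<Longrightarrow>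
      (\<integral>\<^sup>+y\<in>cube a r. ennreal (Phi (\<bar>f y\<bar> / (N * r powr - lam))) \<partial>lebesgue) \<le> ennreal (r ^ CARD('n))"
begin

definition height :: "real \<Rightarrow> real" where
  "height r = N * r powr - lam"

lemma height_pos: "0 < r \<Longrightarrow> 0 < height r"
  using N_pos by (simp add: height_def)

lemma height_antimono: "0 < q \<Longrightarrow> q \<le> r \<Longrightarrow> height r \<le> height q"
  using N_pos lam_pos unfolding height_def by (intro mult_left_mono powr_mono2') auto

lemma mass:
  assumes r: "0 < r"
  shows "(\<integral>\<^sup>+y\<in>cube a r. ennreal \<bar>f y\<bar> \<partial>lebesgue) \<le> ennreal (height r * r ^ CARD('n))"
proof -
  have h: "0 < height r" using height_pos[OF r] .
  have "\<bar>f y\<bar> \<le> height r * Phi (\<bar>f y\<bar> / height r)" for y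
    using Phi_ge[of "\<bar>f y\<bar> / height r"] h by (simp add: field_simps)
  then have "ennreal \<bar>f y\<bar> \<le> ennreal (height r) * ennreal (Phi (\<bar>f y\<bar> / height r))" for y
    using h Phi_nonneg[of "\<bar>f y\<bar> / height r"] by (simp add: ennreal_mult[symmetric] ennreal_leI)
  then have "(\<integral>\<^sup>+y\<in>cube a r. ennreal \<bar>f y\<bar> \<partial>lebesgue) \<le>
      (\<integral>\<^sup>+y. ennreal (height r) * (ennreal (Phi (\<bar>f y\<bar> / height r)) * indicator (cube a r) y) \<partial>lebesgue)"
    by (intro nn_integral_mono) (auto split: split_indicator)
  also have "\<dots> = ennreal (height r) * (\<integral>\<^sup>+y\<in>cube a r. ennreal (Phi (\<bar>f y\<bar> / height r)) \<partial>lebesgue)"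
    by (rule nn_integral_cmult) measurable
  also have "\<dots> \<le> ennreal (height r) * ennreal (r ^ CARD('n))"
    unfolding height_def by (intro mult_left_mono Phi_mass r) auto
  also have "\<dots> = ennreal (height r * r ^ CARD('n))" using h r by (simp add: ennreal_mult)
  finally show ?thesis .
qed

lemma mass_dilate1:
  assumes q: "0 < q"
  shows "(\<integral>\<^sup>+y\<in>dilate 1 a q. ennreal \<bar>f y\<bar> \<partial>lebesgue) \<le> ennreal (height q * (3 ^ CARD('n) * q ^ CARD('n)))"
proof -
  have "(\<integral>\<^sup>+y\<in>dilate 1 a q. ennreal \<bar>f y\<bar> \<partial>lebesgue) \<le> ennreal (height (3 * q) * (3 * q) ^ CARD('n))"
    unfolding dilate_def using mass[of "3 * q"] q by simp
  also have "\<dots> \<le> ennreal (height q * (3 ^ CARD('n) * q ^ CARD('n)))"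
    unfolding power_mult_distrib using q by (intro ennreal_leI mult_right_mono height_antimono) auto
  finally show ?thesis .
qed

lemma Phi_mass_dilate1:
  assumes q: "0 < q" and \<sigma>: "height q \<le> \<sigma>"
  shows "(\<integral>\<^sup>+y\<in>dilate 1 a q. ennreal (Phi (\<bar>f y\<bar> / \<sigma>)) \<partial>lebesgue)
    \<le> ennreal (height q / \<sigma> * (3 ^ CARD('n) * q ^ CARD('n)))"
proof -
  have h: "0 < height q" "0 < height (3 * q)" "height (3 * q) \<le> height q" 
    using height_pos[of q] height_pos[of "3 * q"] height_antimono[of q "3 * q"] q by auto
  have \<sigma>0: "0 < \<sigma>" using h \<sigma> by linarith
  have "ennreal (Phi (\<bar>f y\<bar> / \<sigma>)) \<le> ennreal (height q / \<sigma>) * ennreal (Phi (\<bar>f y\<bar> / height (3 * q)))" for y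
  proof -
    have "Phi (\<bar>f y\<bar> / \<sigma>) = Phi (height q / \<sigma> * (\<bar>f y\<bar> / height q))" using h by simp
    also have "\<dots> \<le> height q / \<sigma> * Phi (\<bar>f y\<bar> / height q)"
      using h \<sigma>0 \<sigma> by (intro Phi_contract) auto
    also have "\<dots> \<le> height q / \<sigma> * Phi (\<bar>f y\<bar> / height (3 * q))"
      using h \<sigma>0 by (intro mult_left_mono Phi_mono divide_left_mono) auto
    finally show ?thesis
      using h \<sigma>0 Phi_nonneg[of "\<bar>f y\<bar> / height (3 * q)"] by (simp add: ennreal_mult[symmetric] ennreal_leI)
  qed
  then have "(\<integral>\<^sup>+y\<in>dilate 1 a q. ennreal (Phi (\<bar>f y\<bar> / \<sigma>)) \<partial>lebesgue) \<le>
      (\<integral>\<^sup>+y. ennreal (height q / \<sigma>) * (ennreal (Phi (\<bar>f y\<bar> / height (3 * q))) * indicator (dilate 1 a q) y) \<partial>lebesgue)"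
    by (intro nn_integral_mono) (auto split: split_indicator)
  also have "\<dots> = ennreal (height q / \<sigma>) * (\<integral>\<^sup>+y\<in>dilate 1 a q. ennreal (Phi (\<bar>f y\<bar> / height (3 * q))) \<partial>lebesgue)"
    by (rule nn_integral_cmult) measurable
  also have "\<dots> \<le> ennreal (height q / \<sigma>) * ennreal ((3 * q) ^ CARD('n))"
    unfolding dilate_def height_def using Phi_mass[of "3 * q"] q by (intro mult_left_mono) auto
  also have "\<dots> = ennreal (height q / \<sigma> * (3 ^ CARD('n) * q ^ CARD('n)))"
    using h \<sigma>0 q unfolding power_mult_distrib by (intro ennreal_mult[symmetric]) auto
  finally show ?thesis .
qed

text \<open>Cubes larger than \<open>Q\<close> have means at most \<open>height q\<close>. Below that level the claim is trivial, because the
  bound exceeds \<open>|Q|\<close>; above it only small cubes matter, and these stay in the triple of \<open>Q\<close>.\<close>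

lemma maximal_weak_type:
  assumes q: "0 < q" and s: "0 < s"
  obtains E where "E \<in> sets lebesgue"
    "emeasure lebesgue E \<le> ennreal (vitali_factor TYPE('n) * 3 ^ CARD('n) * (height q * q ^ CARD('n) / s))"
    "\<And>x c r. x \<in> cube a q \<Longrightarrow> 0 < r \<Longrightarrow> x \<in> cube c r \<Longrightarrow>
       ennreal (s * r ^ CARD('n)) < (\<integral>\<^sup>+y\<in>cube c r. ennreal \<bar>f y\<bar> \<partial>lebesgue) \<Longrightarrow> x \<in> E"
proof (cases "s < height q")
  case True
  have "ennreal (3 ^ CARD('n) * q ^ CARD('n)) \<le> ennreal (vitali_factor TYPE('n) * 3 ^ CARD('n) * (height q * q ^ CARD('n) / s))"
  proof (rule ennreal_leI)
    have "1 * 3 ^ CARD('n) * (1 * q ^ CARD('n)) \<le> vitali_factor TYPE('n) * 3 ^ CARD('n) * (height q / s * q ^ CARD('n))"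
      using True q s vitali_factor_ge1[where 'n='n] by (intro mult_mono) auto
    then show "3 ^ CARD('n) * q ^ CARD('n) \<le> vitali_factor TYPE('n) * 3 ^ CARD('n) * (height q * q ^ CARD('n) / s)" by simp
  qed
  moreover have "x \<in> dilate 1 a q" if "x \<in> cube a q" for x
    using dilate_mono[of q 1 a] q that by auto
  ultimately show thesis using that[of "dilate 1 a q"] q by (simp add: emeasure_dilate1)
next
  case False
  define F where "F = {(c, r). 0 < r \<and> r \<le> q \<and> cube c r \<subseteq> dilate 1 a q \<and>
     ennreal (s * r ^ CARD('n)) < (\<integral>\<^sup>+y\<in>cube c r. ennreal \<bar>f y\<bar> \<partial>lebesgue)}"
  let ?D = "\<lambda>(c, r). dilate (3 * real CARD('n)) c r"
  obtain C where C: "C \<subseteq> F" "(\<Union>j\<in>C. ?D j) \<in> sets lebesgue"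
    "emeasure lebesgue (\<Union>j\<in>C. ?D j) \<le> 1 * ennreal (vitali_factor TYPE('n)) * ennreal (1 / s) * (\<integral>\<^sup>+y\<in>dilate 1 a q. ennreal \<bar>f y\<bar> \<partial>lebesgue)"
    "\<And>a r. (a, r) \<in> F \<Longrightarrow> \<exists>(c, s)\<in>C. cube a r \<subseteq> interior (dilate (3 * real CARD('n)) c s)"
  proof (rule Vitali_selection_bound[where F=F and D=q and P="dilate 1 a q" and E="?D" and \<eta>=1
        and \<kappa>="ennreal (1 / s)" and g="\<lambda>y. ennreal \<bar>f y\<bar>"])
    fix c r assume cr: "(c, r) \<in> F"
    then show "0 < r \<and> r \<le> q \<and> cube c r \<subseteq> dilate 1 a q" by (auto simp: F_def)
    have "ennreal (r ^ CARD('n)) = ennreal (1 / s) * ennreal (s * r ^ CARD('n))"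
      using s cr by (subst ennreal_mult[symmetric]) (auto simp: F_def)
    also have "\<dots> \<le> ennreal (1 / s) * (\<integral>\<^sup>+y\<in>cube c r. ennreal \<bar>f y\<bar> \<partial>lebesgue)"
      using cr by (intro mult_left_mono) (auto simp: F_def)
    finally show "ennreal (r ^ CARD('n)) \<le> ennreal (1 / s) * (\<integral>\<^sup>+y\<in>cube c r. ennreal \<bar>f y\<bar> \<partial>lebesgue)" .
  qed (auto intro: that)
  note C(3)
  also have "1 * ennreal (vitali_factor TYPE('n)) * ennreal (1 / s) * (\<integral>\<^sup>+y\<in>dilate 1 a q. ennreal \<bar>f y\<bar> \<partial>lebesgue)
      \<le> 1 * ennreal (vitali_factor TYPE('n)) * ennreal (1 / s) * ennreal (height q * (3 ^ CARD('n) * q ^ CARD('n)))"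
    by (rule mult_left_mono[OF mass_dilate1[OF q]]) simp
  also have "\<dots> = ennreal (vitali_factor TYPE('n) * 3 ^ CARD('n) * (height q * q ^ CARD('n) / s))"
    using s q height_pos[OF q] vitali_factor_ge1[where 'n='n] by (simp add: ennreal_mult[symmetric] mult_ac)
  finally have "emeasure lebesgue (\<Union>j\<in>C. ?D j) \<le> ennreal (vitali_factor TYPE('n) * 3 ^ CARD('n) * (height q * q ^ CARD('n) / s))" .
  moreover have "x \<in> (\<Union>j\<in>C. ?D j)" if x: "x \<in> cube a q" "0 < r" "x \<in> cube c r" 
    and big: "ennreal (s * r ^ CARD('n)) < (\<integral>\<^sup>+y\<in>cube c r. ennreal \<bar>f y\<bar> \<partial>lebesgue)" for x c r
  proof -
    have "r \<le> q"
    proof (rule ccontr)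
      assume "\<not> r \<le> q"
      then have "height r \<le> s" using height_antimono[of q r] q False by simp
      then have "ennreal (height r * r ^ CARD('n)) \<le> ennreal (s * r ^ CARD('n))"
        using x(2) by (intro ennreal_leI mult_right_mono) auto
      then show False using mass[OF x(2), of c] big by simp
    qed
    then have "(c, r) \<in> F" using x big cube_subset_dilate1[of r q x c a] by (auto simp: F_def)
    then obtain c' s' where "(c', s') \<in> C" "cube c r \<subseteq> interior (dilate (3 * real CARD('n)) c' s')" using C(4) by blast
    then show ?thesis using x(3) interior_subset by blast
  qed
  ultimately show thesis using that[OF C(2)] by blast
qed

end

section \<open>The maximal commutator\<close>

locale commutator_pair = bounded_oscillation b B \<Lambda> + zygmund_morrey_function f lam N
  for b :: "real ^ 'n::finite \<Rightarrow> real" and B \<Lambda> and f :: "real ^ 'n \<Rightarrow> real" and lam N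
begin

text \<open>If the mean of \<open>|b - b\<^sub>R| |f|\<close> over \<open>R\<close> exceeds \<open>s\<close>, the pairing inequality at the scale
  \<open>\<sigma> = s / (32 \<Lambda>)\<close> forces the mean of \<open>Phi (|f| / \<sigma>)\<close> over \<open>R\<close> to exceed 1: the 32 is twice \<open>15 + 1\<close>,
  where 15 is the exponential mean. The covering lemma then applies with density 1.\<close>

lemma small_cubes_pairing:
  assumes q: "0 < q" and s: "0 < s"
  obtains E where "E \<in> sets lebesgue"
    "emeasure lebesgue E \<le> ennreal (32 * vitali_factor TYPE('n) * 3 ^ CARD('n) * (\<Lambda> * height q * q ^ CARD('n) / s))"
    "\<And>c r. 0 < r \<Longrightarrow> r \<le> q \<Longrightarrow> cube c r \<subseteq> dilate 1 a q \<Longrightarrow>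
       ennreal (s * r ^ CARD('n)) < (\<integral>\<^sup>+y\<in>cube c r. ennreal (\<bar>b y - av c r\<bar> * \<bar>f y\<bar>) \<partial>lebesgue) \<Longrightarrow> cube c r \<subseteq> E"
proof -
  define \<sigma> where "\<sigma> = s / (32 * \<Lambda>)"
  have \<sigma>: "0 < \<sigma>" using s \<Lambda>_pos by (simp add: \<sigma>_def)
  have bound: "vitali_factor TYPE('n) * (height q / \<sigma> * (3 ^ CARD('n) * q ^ CARD('n))) =
      32 * vitali_factor TYPE('n) * 3 ^ CARD('n) * (\<Lambda> * height q * q ^ CARD('n) / s)"
    using s \<Lambda>_pos by (simp add: \<sigma>_def)
  show thesis
  proof (cases "\<sigma> < height q")
    case True
    have "1 * (1 * (3 ^ CARD('n) * q ^ CARD('n))) \<le> vitali_factor TYPE('n) * (height q / \<sigma> * (3 ^ CARD('n) * q ^ CARD('n)))"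
      using True q \<sigma> vitali_factor_ge1[where 'n='n] by (intro mult_mono) auto
    then have "emeasure lebesgue (dilate 1 a q) \<le> ennreal (32 * vitali_factor TYPE('n) * 3 ^ CARD('n) * (\<Lambda> * height q * q ^ CARD('n) / s))"
      using q unfolding bound by (simp add: emeasure_dilate1 ennreal_leI)
    then show thesis using that[of "dilate 1 a q"] by simp
  next
    case False
    define F where "F = {(c, r). 0 < r \<and> r \<le> q \<and> cube c r \<subseteq> dilate 1 a q \<and>
       ennreal (s * r ^ CARD('n)) < (\<integral>\<^sup>+y\<in>cube c r. ennreal (\<bar>b y - av c r\<bar> * \<bar>f y\<bar>) \<partial>lebesgue)}"
    let ?D = "\<lambda>(c, r). dilate (3 * real CARD('n)) c r"
    obtain C where C: "C \<subseteq> F" "(\<Union>j\<in>C. ?D j) \<in> sets lebesgue"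
      "emeasure lebesgue (\<Union>j\<in>C. ?D j) \<le> 1 * ennreal (vitali_factor TYPE('n)) * 1 * (\<integral>\<^sup>+y\<in>dilate 1 a q. ennreal (Phi (\<bar>f y\<bar> / \<sigma>)) \<partial>lebesgue)"
      "\<And>a r. (a, r) \<in> F \<Longrightarrow> \<exists>(c, s)\<in>C. cube a r \<subseteq> interior (dilate (3 * real CARD('n)) c s)"
    proof (rule Vitali_selection_bound[where F=F and D=q and P="dilate 1 a q" and E="?D" and \<eta>=1
          and \<kappa>=1 and g="\<lambda>y. ennreal (Phi (\<bar>f y\<bar> / \<sigma>))"])
      fix c r assume cr: "(c, r) \<in> F"
      then show "0 < r \<and> r \<le> q \<and> cube c r \<subseteq> dilate 1 a q" by (auto simp: F_def)
      have r: "0 < r" using cr by (auto simp: F_def)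
      let ?I = "\<integral>\<^sup>+y\<in>cube c r. ennreal (Phi (\<bar>f y\<bar> / \<sigma>)) \<partial>lebesgue"
      show "ennreal (r ^ CARD('n)) \<le> 1 * ?I"
      proof (rule ccontr)
        assume "\<not> ennreal (r ^ CARD('n)) \<le> 1 * ?I"
        then have I: "?I \<le> ennreal (r ^ CARD('n))" by simp
        have "(\<integral>\<^sup>+y\<in>cube c r. ennreal (\<bar>b y - av c r\<bar> * \<bar>f y\<bar>) \<partial>lebesgue) \<le> ennreal (2 * \<Lambda> * \<sigma>) * (ennreal (15 * r ^ CARD('n)) + ?I)"
          using r \<sigma> by (intro oscillation_pairing) auto
        also have "\<dots> \<le> ennreal (2 * \<Lambda> * \<sigma>) * (ennreal (15 * r ^ CARD('n)) + ennreal (r ^ CARD('n)))"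
          by (intro mult_left_mono add_left_mono I) auto
        also have "\<dots> = ennreal (2 * \<Lambda> * \<sigma> * (15 * r ^ CARD('n) + r ^ CARD('n)))"
          using r \<Lambda>_pos \<sigma> by (subst ennreal_plus[symmetric]) (auto simp: ennreal_mult[symmetric])
        also have "2 * \<Lambda> * \<sigma> * (15 * r ^ CARD('n) + r ^ CARD('n)) = s * r ^ CARD('n)"
          using \<Lambda>_pos by (simp add: \<sigma>_def)
        finally show False using cr by (auto simp: F_def)
      qed
    qed (auto intro: that)
    have "emeasure lebesgue (\<Union>j\<in>C. ?D j) \<le> ennreal (vitali_factor TYPE('n)) * (\<integral>\<^sup>+y\<in>dilate 1 a q. ennreal (Phi (\<bar>f y\<bar> / \<sigma>)) \<partial>lebesgue)"
      using C(3) by simp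
    also have "\<dots> \<le> ennreal (vitali_factor TYPE('n)) * ennreal (height q / \<sigma> * (3 ^ CARD('n) * q ^ CARD('n)))"
      using False by (intro mult_left_mono Phi_mass_dilate1 q) auto
    also have "\<dots> = ennreal (32 * vitali_factor TYPE('n) * 3 ^ CARD('n) * (\<Lambda> * height q * q ^ CARD('n) / s))"
      unfolding bound[symmetric] using \<sigma> q height_pos[OF q] vitali_factor_ge1[where 'n='n]
      by (intro ennreal_mult[symmetric]) auto
    finally have "emeasure lebesgue (\<Union>j\<in>C. ?D j) \<le> ennreal (32 * vitali_factor TYPE('n) * 3 ^ CARD('n) * (\<Lambda> * height q * q ^ CARD('n) / s))" .
    moreover have "cube c r \<subseteq> (\<Union>j\<in>C. ?D j)" if "0 < r" "r \<le> q" "cube c r \<subseteq> dilate 1 a q"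
      "ennreal (s * r ^ CARD('n)) < (\<integral>\<^sup>+y\<in>cube c r. ennreal (\<bar>b y - av c r\<bar> * \<bar>f y\<bar>) \<partial>lebesgue)" for c r
    proof -
      have "(c, r) \<in> F" using that by (auto simp: F_def)
      then obtain c' s' where "(c', s') \<in> C" "cube c r \<subseteq> interior (dilate (3 * real CARD('n)) c' s')" using C(4) by blast
      then show ?thesis using interior_subset by blast
    qed
    ultimately show thesis using that[OF C(2)] by blast
  qed
qed

text \<open>Let \<open>w\<close> be the mean of \<open>|f|\<close> over \<open>R\<close> and \<open>m\<close> the integer part of \<open>\<sigma> / w\<close>, where \<open>\<sigma> = s / (2 \<Lambda>)\<close>. The
  cubes with a given \<open>m\<close> have means above \<open>\<sigma> / (m + 1)\<close>, so their selected dilations \<open>P\<close> have total volume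
  \<open>O((m + 1) / \<sigma>)\<close>. On the other hand \<open>|b x - b\<^sub>R| > s / w \<ge> 2 m \<Lambda>\<close>, so \<open>b x\<close> or \<open>b\<^sub>R\<close> is more than
  \<open>m \<Lambda>\<close> away from \<open>b\<^sub>P\<close>, and \<open>x\<close> is exceptional in \<open>P\<close> at level \<open>m\<close>. The sum of
  \<open>(m + 1) 2\<^sup>-\<^sup>m\<close> is 4.\<close>

lemma small_cubes_pointwise:
  assumes q: "0 < q" and s: "0 < s"
  obtains E where "E \<in> sets lebesgue"
    "emeasure lebesgue E \<le> ennreal (8 * vitali_factor TYPE('n) * 3 ^ CARD('n) * (\<Lambda> * height q * q ^ CARD('n) / s))"
    "\<And>x c r. 0 < r \<Longrightarrow> r \<le> q \<Longrightarrow> cube c r \<subseteq> dilate 1 a q \<Longrightarrow> x \<in> cube c r \<Longrightarrow>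
       ennreal (s * r ^ CARD('n)) < ennreal \<bar>b x - av c r\<bar> * (\<integral>\<^sup>+y\<in>cube c r. ennreal \<bar>f y\<bar> \<partial>lebesgue) \<Longrightarrow> x \<in> E"
proof -
  define \<sigma> where "\<sigma> = s / (2 * \<Lambda>)"
  have \<sigma>: "0 < \<sigma>" using s \<Lambda>_pos by (simp add: \<sigma>_def)
  define I where "I = height q * (3 ^ CARD('n) * q ^ CARD('n))"
  have I: "0 \<le> I" using q height_pos[OF q] by (simp add: I_def)
  define F where "F m = {(c, r). 0 < r \<and> r \<le> q \<and> cube c r \<subseteq> dilate 1 a q \<and>
     ennreal (\<sigma> * r ^ CARD('n)) \<le> ennreal (real (Suc m)) * (\<integral>\<^sup>+y\<in>cube c r. ennreal \<bar>f y\<bar> \<partial>lebesgue)}" for m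
  define X where "X m = (\<lambda>(c, t). exceptional (\<chi> i. c $ i - 3 * real CARD('n) * t) ((2 * (3 * real CARD('n)) + 1) * t) m)" for m
  have "\<exists>U. U \<in> sets lebesgue \<and> emeasure lebesgue U \<le> ennreal (real (Suc m) * (1 / 2) ^ m * (vitali_factor TYPE('n) / \<sigma> * I)) \<and>
      (\<forall>c r. (c, r) \<in> F m \<longrightarrow> (\<exists>p \<rho>. 0 < \<rho> \<and> cube c r \<subseteq> interior (cube p \<rho>) \<and> exceptional p \<rho> m \<subseteq> U))" for m
  proof -
    obtain C where C: "C \<subseteq> F m" "(\<Union>j\<in>C. X m j) \<in> sets lebesgue"
      "emeasure lebesgue (\<Union>j\<in>C. X m j) \<le> ennreal ((1 / 2) ^ m) * ennreal (vitali_factor TYPE('n)) * ennreal (real (Suc m) / \<sigma>) *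
         (\<integral>\<^sup>+y\<in>dilate 1 a q. ennreal \<bar>f y\<bar> \<partial>lebesgue)"
      "\<And>a r. (a, r) \<in> F m \<Longrightarrow> \<exists>(c, s)\<in>C. cube a r \<subseteq> interior (dilate (3 * real CARD('n)) c s)"
    proof (rule Vitali_selection_bound[where F="F m" and D=q and P="dilate 1 a q" and E="X m" and \<eta>="ennreal ((1 / 2) ^ m)"
          and \<kappa>="ennreal (real (Suc m) / \<sigma>)" and g="\<lambda>y. ennreal \<bar>f y\<bar>"])
      fix c r assume cr: "(c, r) \<in> F m"
      then show "0 < r \<and> r \<le> q \<and> cube c r \<subseteq> dilate 1 a q" by (auto simp: F_def)
      have r: "0 < r" using cr by (auto simp: F_def)
      have "ennreal (r ^ CARD('n)) = ennreal (1 / \<sigma>) * ennreal (\<sigma> * r ^ CARD('n))"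
        using \<sigma> r by (subst ennreal_mult[symmetric]) auto
      also have "\<dots> \<le> ennreal (1 / \<sigma>) * (ennreal (real (Suc m)) * (\<integral>\<^sup>+y\<in>cube c r. ennreal \<bar>f y\<bar> \<partial>lebesgue))"
        using cr by (intro mult_left_mono) (auto simp: F_def)
      also have "\<dots> = ennreal (real (Suc m) / \<sigma>) * (\<integral>\<^sup>+y\<in>cube c r. ennreal \<bar>f y\<bar> \<partial>lebesgue)"
        using \<sigma> by (simp add: mult.assoc[symmetric] ennreal_mult[symmetric] del: of_nat_Suc)
      finally show "ennreal (r ^ CARD('n)) \<le> ennreal (real (Suc m) / \<sigma>) * (\<integral>\<^sup>+y\<in>cube c r. ennreal \<bar>f y\<bar> \<partial>lebesgue)" .
    next
      fix c t assume ct: "(c, t) \<in> F m"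
      then have t: "0 < (2 * (3 * real CARD('n)) + 1) * t" by (auto simp: F_def)
      have "emeasure lebesgue (X m (c, t)) \<le> ennreal ((1 / 2) ^ m * ((2 * (3 * real CARD('n)) + 1) * t) ^ CARD('n))"
        unfolding X_def using exceptional(2)[OF t] by simp
      also have "\<dots> = ennreal ((1 / 2) ^ m) * emeasure lebesgue (dilate (3 * real CARD('n)) c t)"
        unfolding dilate_def using t by (subst emeasure_cube) (auto simp: ennreal_mult)
      finally show "X m (c, t) \<in> sets lebesgue \<and> emeasure lebesgue (X m (c, t)) \<le>
          ennreal ((1 / 2) ^ m) * emeasure lebesgue (dilate (3 * real CARD('n)) c t)"
        unfolding X_def using exceptional(1)[OF t] by simp
    qed (auto intro: that)
    have "emeasure lebesgue (\<Union>j\<in>C. X m j) \<le> ennreal ((1 / 2) ^ m) * ennreal (vitali_factor TYPE('n)) * ennreal (real (Suc m) / \<sigma>) * ennreal I"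
      using C(3) mass_dilate1[OF q, of a] unfolding I_def by (meson mult_left_mono order_trans zero_le)
    also have "\<dots> = ennreal (real (Suc m) * (1 / 2) ^ m * (vitali_factor TYPE('n) / \<sigma> * I))"
      using \<sigma> I vitali_factor_ge1[where 'n='n] by (simp add: ennreal_mult[symmetric] mult_ac del: of_nat_Suc)
    finally have "emeasure lebesgue (\<Union>j\<in>C. X m j) \<le> ennreal (real (Suc m) * (1 / 2) ^ m * (vitali_factor TYPE('n) / \<sigma> * I))" .
    moreover have "\<exists>p \<rho>. 0 < \<rho> \<and> cube c r \<subseteq> interior (cube p \<rho>) \<and> exceptional p \<rho> m \<subseteq> (\<Union>j\<in>C. X m j)" if cr: "(c, r) \<in> F m" for c r
    proof -
      obtain c' t where ct: "(c', t) \<in> C" "cube c r \<subseteq> interior (dilate (3 * real CARD('n)) c' t)" using C(4)[OF cr] by blast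
      then have "0 < (2 * (3 * real CARD('n)) + 1) * t" using C(1) by (auto simp: F_def)
      moreover have "X m (c', t) \<subseteq> (\<Union>j\<in>C. X m j)" using ct(1) by blast
      ultimately show ?thesis using ct(2) unfolding dilate_def X_def by blast
    qed
    ultimately show ?thesis using C(2) by blast
  qed
  then obtain U where U: "\<And>m. U m \<in> sets lebesgue"
      "\<And>m. emeasure lebesgue (U m) \<le> ennreal (real (Suc m) * (1 / 2) ^ m * (vitali_factor TYPE('n) / \<sigma> * I))"
      "\<And>m c r. (c, r) \<in> F m \<Longrightarrow> \<exists>p \<rho>. 0 < \<rho> \<and> cube c r \<subseteq> interior (cube p \<rho>) \<and> exceptional p \<rho> m \<subseteq> U m"
    by metis
  obtain N0 where N0: "N0 \<in> null_sets lebesgue"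
    "\<And>x p \<rho> m. x \<notin> N0 \<Longrightarrow> 0 < \<rho> \<Longrightarrow> x \<in> interior (cube p \<rho>) \<Longrightarrow> real m * \<Lambda> < \<bar>b x - av p \<rho>\<bar> \<Longrightarrow>
       x \<in> exceptional p \<rho> m"
    by (rule exceptional_at_Lebesgue_points) (rule that)
  show thesis
  proof (rule that[of "(\<Union>m. U m) \<union> N0"])
    show "(\<Union>m. U m) \<union> N0 \<in> sets lebesgue" using U(1) N0(1) by (auto intro: null_setsD2)
    \<comment> \<open>The null set \<open>N0\<close> of points that are not Lebesgue points joins the exceptional set.\<close>
    have "emeasure lebesgue ((\<Union>m. U m) \<union> N0) = emeasure lebesgue (\<Union>m. U m)"
      using U(1) N0(1) by (intro emeasure_Un_null_set) auto
    also have "\<dots> \<le> (\<Sum>m. emeasure lebesgue (U m))"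
      using U(1) by (intro emeasure_subadditive_countably) auto
    also have "\<dots> \<le> (\<Sum>m. ennreal (real (Suc m) * (1 / 2) ^ m * (vitali_factor TYPE('n) / \<sigma> * I)))"
      by (intro suminf_le U(2)) auto
    also have "\<dots> = ennreal (1 / (1 - 1 / 2)\<^sup>2 * (vitali_factor TYPE('n) / \<sigma> * I))"
      using I \<sigma> vitali_factor_ge1[where 'n='n]
      by (intro suminf_ennreal_eq sums_mult2 geometric_deriv_sums) auto
    also have "1 / (1 - 1 / 2)\<^sup>2 * (vitali_factor TYPE('n) / \<sigma> * I) = 8 * vitali_factor TYPE('n) * 3 ^ CARD('n) * (\<Lambda> * height q * q ^ CARD('n) / s)"
      using s \<Lambda>_pos by (simp add: \<sigma>_def I_def power2_eq_square)
    finally show "emeasure lebesgue ((\<Union>m. U m) \<union> N0) \<le> ennreal (8 * vitali_factor TYPE('n) * 3 ^ CARD('n) * (\<Lambda> * height q * q ^ CARD('n) / s))" .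
    fix x c r
    assume r: "0 < r" "r \<le> q" and sub: "cube c r \<subseteq> dilate 1 a q" and x: "x \<in> cube c r"
      and big: "ennreal (s * r ^ CARD('n)) < ennreal \<bar>b x - av c r\<bar> * (\<integral>\<^sup>+y\<in>cube c r. ennreal \<bar>f y\<bar> \<partial>lebesgue)"
    let ?J = "\<integral>\<^sup>+y\<in>cube c r. ennreal \<bar>f y\<bar> \<partial>lebesgue"
    have "?J \<noteq> top" using mass[OF r(1), of c] by (auto simp: top_unique)
    then obtain w where w: "0 \<le> w" "?J = ennreal w" by (cases ?J) auto
    define d where "d = \<bar>b x - av c r\<bar>"
    have dw: "s * r ^ CARD('n) < d * w"
      using big w s r unfolding d_def[symmetric] w(2) by (simp add: ennreal_mult[symmetric] d_def ennreal_less_iff)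
    have "0 < d * w" using dw s r by (smt (verit) mult_pos_pos zero_less_power)
    then have w0: "0 < w" using w(1) by (auto simp: zero_less_mult_iff d_def)
    define u where "u = \<sigma> * r ^ CARD('n) / w"
    have u: "0 < u" using \<sigma> r w0 by (simp add: u_def)
    define m where "m = nat \<lfloor>u\<rfloor>"
    have m: "real m \<le> u" "u < real (Suc m)" using u unfolding m_def by linarith+
    have "(c, r) \<in> F m"
    proof -
      have "\<sigma> * r ^ CARD('n) \<le> real (Suc m) * w" using m(2) w0 by (simp add: u_def field_simps)
      then have "ennreal (\<sigma> * r ^ CARD('n)) \<le> ennreal (real (Suc m)) * ?J"
        unfolding w(2) using w0 by (simp add: ennreal_mult[symmetric] ennreal_leI del: of_nat_Suc)
      then show ?thesis using r sub by (simp add: F_def)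
    qed
    then obtain p \<rho> where p: "0 < \<rho>" "cube c r \<subseteq> interior (cube p \<rho>)" "exceptional p \<rho> m \<subseteq> U m" using U(3) by blast
    have "2 * (real m * \<Lambda>) < d"
    proof -
      have "2 * (real m * \<Lambda>) \<le> 2 * (u * \<Lambda>)" using m(1) \<Lambda>_pos by simp
      also have "\<dots> = s * r ^ CARD('n) / w" using \<Lambda>_pos by (simp add: u_def \<sigma>_def)
      also have "\<dots> < d" using dw w0 by (simp add: field_simps)
      finally show ?thesis .
    qed
    then have "real m * \<Lambda> < \<bar>b x - av p \<rho>\<bar> \<or> real m * \<Lambda> < \<bar>av c r - av p \<rho>\<bar>" unfolding d_def by linarith
    then have "x \<in> exceptional p \<rho> m \<or> x \<in> N0"
    proof
      assume "real m * \<Lambda> < \<bar>b x - av p \<rho>\<bar>"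
      then show ?thesis using N0(2)[OF _ p(1)] x p(2) by blast
    next
      assume "real m * \<Lambda> < \<bar>av c r - av p \<rho>\<bar>"
      then have "cube c r \<subseteq> exceptional p \<rho> m" using p(2) interior_subset by (intro exceptional(3) p(1) r(1)) auto
      then show ?thesis using x by blast
    qed
    then show "x \<in> (\<Union>m. U m) \<union> N0" using p(3) by blast
  qed
qed

end

text \<open>The decay \<open>y\<^bsup>-\<lambda>\<^esup>\<close> of the Morrey normalization beats the logarithmic growth of averages; here
  \<open>\<lambda> > 0\<close> is essential.\<close>

lemma powr_neg_mult_ln_le:
  fixes lam y :: real
  assumes "0 < lam" "1 \<le> y"
  shows "y powr - lam * ln y \<le> 1 / lam"
proof -
  have y: "0 < y" using assms by simp
  have "lam * ln y = ln (y powr lam)" using y by (simp add: ln_powr)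
  also have "\<dots> \<le> y powr lam" using y by (intro order_trans[OF ln_le_minus_one]) auto
  finally have "y powr - lam * (lam * ln y) \<le> y powr - lam * y powr lam"
    by (intro mult_left_mono) auto
  also have "\<dots> = 1" using y by (simp add: powr_add[symmetric])
  finally show ?thesis using assms(1) by (simp add: field_simps)
qed

context commutator_pair
begin

lemma B_le_\<Lambda>: "B \<le> \<Lambda>"
proof -
  have "B \<le> 2 * vitali_factor TYPE('n) * B" using vitali_factor_ge1[where 'n='n] B_pos by simp
  then show ?thesis by (simp add: \<Lambda>_def)
qed

text \<open>Pass to the triple of \<open>R\<close>, which contains \<open>Q\<close>, at the cost of \<open>3\<^sup>n\<close>, and split \<open>b x - b y\<close> at the averages
  over \<open>Q\<close> and over the triple. The constant 33 collects 32 from the pairing inequality and 1 from the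
  logarithmic growth.\<close>

lemma large_cube_bound:
  assumes q: "0 < q" and r: "q \<le> r" and x: "x \<in> cube a q" "x \<in> cube c r"
  shows "(\<integral>\<^sup>+y\<in>cube c r. ennreal (\<bar>b x - b y\<bar> * \<bar>f y\<bar>) \<partial>lebesgue)
    \<le> ennreal (3 ^ CARD('n) * height q * (\<bar>b x - av a q\<bar> + \<Lambda> * (33 + real CARD('n) / (lam * ln 2))) * r ^ CARD('n))"
proof -
  define c' where "c' = (\<chi> i. c $ i - 1 * r)"
  define r' where "r' = 3 * r"
  have R': "dilate 1 c r = cube c' r'" by (simp add: dilate_def c'_def r'_def)
  have r': "0 < r'" "q \<le> r'" using q r by (auto simp: r'_def)
  have sub: "cube a q \<subseteq> cube c' r'" using cube_subset_dilate1[OF r x] R' by simp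
  have subR: "cube c r \<subseteq> cube c' r'" using dilate_mono[of r 1 c] q r R' by simp
  define h where "h = height r'"
  have h: "0 < h" "h \<le> height q" using height_pos[OF r'(1)] height_antimono[OF q r'(2)] by (auto simp: h_def)
  define d1 where "d1 = \<bar>b x - av a q\<bar>"
  define d2 where "d2 = \<bar>av a q - av c' r'\<bar>"
  have hd2: "h * d2 \<le> height q * \<Lambda> * (1 + real CARD('n) / (lam * ln 2))"
  proof -
    define y where "y = r' / q"
    have y: "1 \<le> y" using r' q by (simp add: y_def)
    have hy: "h = height q * y powr - lam"
      using q r' unfolding h_def height_def y_def by (simp add: powr_divide powr_minus_divide)
    have "h * d2 \<le> h * (\<Lambda> * (1 + real CARD('n) * ln y / ln 2))"
      unfolding d2_def y_def using average_log_growth[OF q sub] h by (intro mult_left_mono) auto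
    also have "\<dots> = \<Lambda> * (h + height q * (real CARD('n) / ln 2 * (y powr - lam * ln y)))"
      by (simp add: hy algebra_simps)
    also have "\<dots> \<le> \<Lambda> * (height q + height q * (real CARD('n) / ln 2 * (1 / lam)))"
      using \<Lambda>_pos h height_pos[OF q] powr_neg_mult_ln_le[OF lam_pos y]
      by (intro mult_left_mono add_mono) auto
    also have "\<dots> = height q * \<Lambda> * (1 + real CARD('n) / (lam * ln 2))" by (simp add: algebra_simps)
    finally show ?thesis .
  qed
  have ptw: "ennreal (\<bar>b x - b y\<bar> * \<bar>f y\<bar>) * indicator (cube c r) y \<le>
      ennreal (d1 + d2) * (ennreal \<bar>f y\<bar> * indicator (cube c' r') y) +
      ennreal (\<bar>b y - av c' r'\<bar> * \<bar>f y\<bar>) * indicator (cube c' r') y" for y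
  proof (cases "y \<in> cube c r")
    case True
    have "\<bar>b x - b y\<bar> * \<bar>f y\<bar> \<le> (d1 + d2 + \<bar>b y - av c' r'\<bar>) * \<bar>f y\<bar>"
      unfolding d1_def d2_def by (intro mult_right_mono) auto
    then have "ennreal (\<bar>b x - b y\<bar> * \<bar>f y\<bar>) \<le> ennreal ((d1 + d2) * \<bar>f y\<bar> + \<bar>b y - av c' r'\<bar> * \<bar>f y\<bar>)"
      by (intro ennreal_leI) (simp add: algebra_simps)
    then show ?thesis using True subR by (auto simp: ennreal_mult ennreal_plus d1_def d2_def)
  qed simp
  have "(\<integral>\<^sup>+y\<in>cube c r. ennreal (\<bar>b x - b y\<bar> * \<bar>f y\<bar>) \<partial>lebesgue) \<le>
      (\<integral>\<^sup>+y. ennreal (d1 + d2) * (ennreal \<bar>f y\<bar> * indicator (cube c' r') y) +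
        ennreal (\<bar>b y - av c' r'\<bar> * \<bar>f y\<bar>) * indicator (cube c' r') y \<partial>lebesgue)"
    by (intro nn_integral_mono ptw)
  also have "\<dots> = ennreal (d1 + d2) * (\<integral>\<^sup>+y\<in>cube c' r'. ennreal \<bar>f y\<bar> \<partial>lebesgue) +
      (\<integral>\<^sup>+y\<in>cube c' r'. ennreal (\<bar>b y - av c' r'\<bar> * \<bar>f y\<bar>) \<partial>lebesgue)"
    by (subst nn_integral_add) (auto simp: nn_integral_cmult)
  also have "\<dots> \<le> ennreal (d1 + d2) * ennreal (h * r' ^ CARD('n)) +
      ennreal (2 * \<Lambda> * h) * (ennreal (15 * r' ^ CARD('n)) + ennreal (r' ^ CARD('n)))"
  proof (intro add_mono mult_left_mono)
    show "(\<integral>\<^sup>+y\<in>cube c' r'. ennreal \<bar>f y\<bar> \<partial>lebesgue) \<le> ennreal (h * r' ^ CARD('n))"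
      unfolding h_def by (rule mass[OF r'(1)])
    have "(\<integral>\<^sup>+y\<in>cube c' r'. ennreal (\<bar>b y - av c' r'\<bar> * \<bar>f y\<bar>) \<partial>lebesgue) \<le>
      ennreal (2 * \<Lambda> * h) * (ennreal (15 * r' ^ CARD('n)) + (\<integral>\<^sup>+y\<in>cube c' r'. ennreal (Phi (\<bar>f y\<bar> / h)) \<partial>lebesgue))"
      using r' h by (intro oscillation_pairing) auto
    also have "\<dots> \<le> ennreal (2 * \<Lambda> * h) * (ennreal (15 * r' ^ CARD('n)) + ennreal (r' ^ CARD('n)))"
      using Phi_mass[OF r'(1), of c'] unfolding h_def height_def by (intro mult_left_mono add_left_mono) auto
    finally show "(\<integral>\<^sup>+y\<in>cube c' r'. ennreal (\<bar>b y - av c' r'\<bar> * \<bar>f y\<bar>) \<partial>lebesgue) \<le>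
      ennreal (2 * \<Lambda> * h) * (ennreal (15 * r' ^ CARD('n)) + ennreal (r' ^ CARD('n)))" .
  qed auto
  also have "\<dots> = ennreal ((d1 + d2) * (h * r' ^ CARD('n)) + 2 * \<Lambda> * h * (15 * r' ^ CARD('n) + r' ^ CARD('n)))"
    using r' h \<Lambda>_pos by (simp add: ennreal_mult[symmetric] ennreal_plus[symmetric] d1_def d2_def del: ennreal_plus)
  also have "\<dots> \<le> ennreal (3 ^ CARD('n) * height q * (d1 + \<Lambda> * (33 + real CARD('n) / (lam * ln 2))) * r ^ CARD('n))"
  proof (rule ennreal_leI)
    have "(d1 + d2) * (h * r' ^ CARD('n)) + 2 * \<Lambda> * h * (15 * r' ^ CARD('n) + r' ^ CARD('n)) =
        (h * d1 + h * d2 + h * (32 * \<Lambda>)) * r' ^ CARD('n)" by (simp add: algebra_simps)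
    also have "\<dots> \<le> (height q * d1 + height q * \<Lambda> * (1 + real CARD('n) / (lam * ln 2)) + height q * (32 * \<Lambda>)) * r' ^ CARD('n)"
      using h hd2 \<Lambda>_pos r' by (intro mult_right_mono add_mono) (auto simp: d1_def)
    also have "\<dots> = 3 ^ CARD('n) * height q * (d1 + \<Lambda> * (33 + real CARD('n) / (lam * ln 2))) * r ^ CARD('n)"
      unfolding r'_def power_mult_distrib by (simp add: algebra_simps)
    finally show "(d1 + d2) * (h * r' ^ CARD('n)) + 2 * \<Lambda> * h * (15 * r' ^ CARD('n) + r' ^ CARD('n))
       \<le> 3 ^ CARD('n) * height q * (d1 + \<Lambda> * (33 + real CARD('n) / (lam * ln 2))) * r ^ CARD('n)" .
  qed
  finally show ?thesis unfolding d1_def .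
qed

lemma large_cubes:
  assumes q: "0 < q" and s: "0 < s"
  obtains E where "E \<in> sets lebesgue"
    "emeasure lebesgue E \<le> ennreal (3 ^ CARD('n) * (34 + real CARD('n) / (lam * ln 2)) * (\<Lambda> * height q * q ^ CARD('n) / s))"
    "\<And>x c r. x \<in> cube a q \<Longrightarrow> q \<le> r \<Longrightarrow> x \<in> cube c r \<Longrightarrow>
       ennreal (s * r ^ CARD('n)) < (\<integral>\<^sup>+y\<in>cube c r. ennreal (\<bar>b x - b y\<bar> * \<bar>f y\<bar>) \<partial>lebesgue) \<Longrightarrow> x \<in> E"
proof -
  define K where "K = 33 + real CARD('n) / (lam * ln 2)"
  have K: "0 \<le> K" using lam_pos by (simp add: K_def add_nonneg_nonneg)
  define A where "A = 3 ^ CARD('n) * height q"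
  have A: "0 < A" using height_pos[OF q] by (simp add: A_def)
  define u where "u x = ennreal (A * (\<bar>b x - av a q\<bar> + \<Lambda> * K))" for x
  have u [measurable]: "u \<in> borel_measurable lebesgue" unfolding u_def by measurable
  define E where "E = {x \<in> cube a q. 1 \<le> ennreal (1 / s) * u x}"
  show thesis
  proof (rule that[of E])
    have "{x \<in> space lebesgue. 1 \<le> ennreal (1 / s) * u x} \<in> sets lebesgue" by measurable
    then have "cube a q \<inter> {x. 1 \<le> ennreal (1 / s) * u x} \<in> sets lebesgue" by (intro sets.Int) auto
    moreover have "E = cube a q \<inter> {x. 1 \<le> ennreal (1 / s) * u x}" by (auto simp: E_def)
    ultimately show "E \<in> sets lebesgue" by simp
    have "emeasure lebesgue E \<le> ennreal (1 / s) * (\<integral>\<^sup>+x\<in>cube a q. u x \<partial>lebesgue)"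
      unfolding E_def by (rule nn_integral_Markov_inequality) auto
    also have "(\<integral>\<^sup>+x\<in>cube a q. u x \<partial>lebesgue) =
        (\<integral>\<^sup>+x. ennreal A * (ennreal \<bar>b x - av a q\<bar> * indicator (cube a q) x + ennreal (\<Lambda> * K) * indicator (cube a q) x) \<partial>lebesgue)"
      using A K \<Lambda>_pos by (intro nn_integral_cong) (auto simp: u_def ennreal_mult ennreal_plus split: split_indicator)
    also have "\<dots> = ennreal A * ((\<integral>\<^sup>+x\<in>cube a q. ennreal \<bar>b x - av a q\<bar> \<partial>lebesgue) + ennreal (\<Lambda> * K) * ennreal (q ^ CARD('n)))"
      using q by (subst nn_integral_cmult) (auto simp: nn_integral_add nn_integral_cmult emeasure_cube)
    also have "ennreal (1 / s) * \<dots> \<le> ennreal (1 / s) * (ennreal A * (ennreal (B * q ^ CARD('n)) + ennreal (\<Lambda> * K) * ennreal (q ^ CARD('n))))"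
      by (intro mult_left_mono add_right_mono osc q) auto
    also have "\<dots> = ennreal (1 / s * (A * (B * q ^ CARD('n) + \<Lambda> * K * q ^ CARD('n))))"
      using q s A K \<Lambda>_pos B_pos by (simp add: ennreal_mult[symmetric] ennreal_plus[symmetric] del: ennreal_plus)
    also have "\<dots> \<le> ennreal (1 / s * (A * (\<Lambda> * q ^ CARD('n) + \<Lambda> * K * q ^ CARD('n))))"
      using q s A B_le_\<Lambda> by (intro ennreal_leI mult_left_mono add_right_mono mult_right_mono) auto
    also have "1 / s * (A * (\<Lambda> * q ^ CARD('n) + \<Lambda> * K * q ^ CARD('n))) =
        3 ^ CARD('n) * (34 + real CARD('n) / (lam * ln 2)) * (\<Lambda> * height q * q ^ CARD('n) / s)"
      unfolding A_def K_def by (simp add: field_simps)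
    finally show "emeasure lebesgue E \<le> ennreal (3 ^ CARD('n) * (34 + real CARD('n) / (lam * ln 2)) * (\<Lambda> * height q * q ^ CARD('n) / s))" .
    fix x c r
    assume x: "x \<in> cube a q" and r: "q \<le> r" and xc: "x \<in> cube c r"
      and big: "ennreal (s * r ^ CARD('n)) < (\<integral>\<^sup>+y\<in>cube c r. ennreal (\<bar>b x - b y\<bar> * \<bar>f y\<bar>) \<partial>lebesgue)"
    have r0: "0 < r" using q r by simp
    have "ennreal (s * r ^ CARD('n)) < ennreal (A * (\<bar>b x - av a q\<bar> + \<Lambda> * K) * r ^ CARD('n))"
      using big large_cube_bound[OF q r x xc] unfolding A_def K_def by (rule less_le_trans)
    then have "s * r ^ CARD('n) < A * (\<bar>b x - av a q\<bar> + \<Lambda> * K) * r ^ CARD('n)"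
      using s r0 by (simp add: ennreal_less_iff)
    then have "s < A * (\<bar>b x - av a q\<bar> + \<Lambda> * K)" using r0 by simp
    then have "1 \<le> 1 / s * (A * (\<bar>b x - av a q\<bar> + \<Lambda> * K))" using s by (simp add: field_simps)
    then have "ennreal 1 \<le> ennreal (1 / s * (A * (\<bar>b x - av a q\<bar> + \<Lambda> * K)))" by (rule ennreal_leI)
    also have "\<dots> = ennreal (1 / s) * u x" unfolding u_def using s A K \<Lambda>_pos by (intro ennreal_mult) auto
    finally show "x \<in> E" using x by (simp add: E_def)
  qed
qed

text \<open>For a small cube one of two terms has to exceed \<open>s / 2\<close>; hence \<open>80 = 2 (32 + 8)\<close>.\<close>

lemma maximal_commutator_weak_type:
  assumes q: "0 < q" and s: "0 < s"
  obtains E where "E \<in> sets lebesgue"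
    "emeasure lebesgue E \<le> ennreal (3 ^ CARD('n) * (80 * vitali_factor TYPE('n) + 34 + real CARD('n) / (lam * ln 2)) *
       (\<Lambda> * height q * q ^ CARD('n) / s))"
    "\<And>x c r. x \<in> cube a q \<Longrightarrow> 0 < r \<Longrightarrow> x \<in> cube c r \<Longrightarrow>
       ennreal (s * r ^ CARD('n)) < (\<integral>\<^sup>+y\<in>cube c r. ennreal (\<bar>b x - b y\<bar> * \<bar>f y\<bar>) \<partial>lebesgue) \<Longrightarrow> x \<in> E"
proof -
  define Y where "Y = \<Lambda> * height q * q ^ CARD('n) / s"
  have Y: "0 \<le> Y" using \<Lambda>_pos height_pos[OF q] q s by (simp add: Y_def)
  have half: "\<Lambda> * height q * q ^ CARD('n) / (s / 2) = 2 * Y" by (simp add: Y_def)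
  have s2: "0 < s / 2" using s by simp
  obtain E1 where E1: "E1 \<in> sets lebesgue"
    "emeasure lebesgue E1 \<le> ennreal (32 * vitali_factor TYPE('n) * 3 ^ CARD('n) * (2 * Y))"
    "\<And>c r. 0 < r \<Longrightarrow> r \<le> q \<Longrightarrow> cube c r \<subseteq> dilate 1 a q \<Longrightarrow>
       ennreal (s / 2 * r ^ CARD('n)) < (\<integral>\<^sup>+y\<in>cube c r. ennreal (\<bar>b y - av c r\<bar> * \<bar>f y\<bar>) \<partial>lebesgue) \<Longrightarrow> cube c r \<subseteq> E1"
    by (rule small_cubes_pairing[OF q s2, where a=a, unfolded half]) (rule that)
  obtain E2 where E2: "E2 \<in> sets lebesgue"
    "emeasure lebesgue E2 \<le> ennreal (8 * vitali_factor TYPE('n) * 3 ^ CARD('n) * (2 * Y))"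
    "\<And>x c r. 0 < r \<Longrightarrow> r \<le> q \<Longrightarrow> cube c r \<subseteq> dilate 1 a q \<Longrightarrow> x \<in> cube c r \<Longrightarrow>
       ennreal (s / 2 * r ^ CARD('n)) < ennreal \<bar>b x - av c r\<bar> * (\<integral>\<^sup>+y\<in>cube c r. ennreal \<bar>f y\<bar> \<partial>lebesgue) \<Longrightarrow> x \<in> E2"
    by (rule small_cubes_pointwise[OF q s2, where a=a, unfolded half]) (rule that)
  obtain E3 where E3: "E3 \<in> sets lebesgue"
    "emeasure lebesgue E3 \<le> ennreal (3 ^ CARD('n) * (34 + real CARD('n) / (lam * ln 2)) * Y)"
    "\<And>x c r. x \<in> cube a q \<Longrightarrow> q \<le> r \<Longrightarrow> x \<in> cube c r \<Longrightarrow>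
       ennreal (s * r ^ CARD('n)) < (\<integral>\<^sup>+y\<in>cube c r. ennreal (\<bar>b x - b y\<bar> * \<bar>f y\<bar>) \<partial>lebesgue) \<Longrightarrow> x \<in> E3"
    by (rule large_cubes[OF q s, where a=a, folded Y_def]) (rule that)
  have v: "0 \<le> vitali_factor TYPE('n)" using vitali_factor_ge1[where 'n='n] by simp
  show thesis
  proof (rule that[of "E1 \<union> E2 \<union> E3"])
    show "E1 \<union> E2 \<union> E3 \<in> sets lebesgue" using E1(1) E2(1) E3(1) by auto
    have "emeasure lebesgue (E1 \<union> E2 \<union> E3) \<le> emeasure lebesgue E1 + emeasure lebesgue E2 + emeasure lebesgue E3"
      using E1(1) E2(1) E3(1) by (intro order_trans[OF emeasure_subadditive] add_right_mono emeasure_subadditive) auto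
    also have "\<dots> \<le> ennreal (32 * vitali_factor TYPE('n) * 3 ^ CARD('n) * (2 * Y)) + ennreal (8 * vitali_factor TYPE('n) * 3 ^ CARD('n) * (2 * Y)) +
        ennreal (3 ^ CARD('n) * (34 + real CARD('n) / (lam * ln 2)) * Y)"
      by (intro add_mono E1 E2 E3)
    also have "\<dots> = ennreal (32 * vitali_factor TYPE('n) * 3 ^ CARD('n) * (2 * Y) + 8 * vitali_factor TYPE('n) * 3 ^ CARD('n) * (2 * Y) +
        3 ^ CARD('n) * (34 + real CARD('n) / (lam * ln 2)) * Y)"
      using Y v lam_pos by (simp add: ennreal_plus[symmetric] add_nonneg_nonneg del: ennreal_plus)
    also have "32 * vitali_factor TYPE('n) * 3 ^ CARD('n) * (2 * Y) + 8 * vitali_factor TYPE('n) * 3 ^ CARD('n) * (2 * Y) +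
        3 ^ CARD('n) * (34 + real CARD('n) / (lam * ln 2)) * Y =
        3 ^ CARD('n) * (80 * vitali_factor TYPE('n) + 34 + real CARD('n) / (lam * ln 2)) * Y"
      by (simp add: algebra_simps)
    finally show "emeasure lebesgue (E1 \<union> E2 \<union> E3) \<le> ennreal (3 ^ CARD('n) * (80 * vitali_factor TYPE('n) + 34 + real CARD('n) / (lam * ln 2)) *
       (\<Lambda> * height q * q ^ CARD('n) / s))" unfolding Y_def .
    fix x c r
    assume x: "x \<in> cube a q" and r: "0 < r" and xc: "x \<in> cube c r"
      and big: "ennreal (s * r ^ CARD('n)) < (\<integral>\<^sup>+y\<in>cube c r. ennreal (\<bar>b x - b y\<bar> * \<bar>f y\<bar>) \<partial>lebesgue)"
    show "x \<in> E1 \<union> E2 \<union> E3"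
    proof (cases "q \<le> r")
      case True
      then show ?thesis using E3(3)[OF x True xc big] by blast
    next
      case False
      have sub: "cube c r \<subseteq> dilate 1 a q" using cube_subset_dilate1[of r q x c a] False x xc by simp
      let ?I1 = "\<integral>\<^sup>+y\<in>cube c r. ennreal (\<bar>b y - av c r\<bar> * \<bar>f y\<bar>) \<partial>lebesgue"
      let ?I2 = "ennreal \<bar>b x - av c r\<bar> * (\<integral>\<^sup>+y\<in>cube c r. ennreal \<bar>f y\<bar> \<partial>lebesgue)"
      have ptw: "ennreal (\<bar>b x - b y\<bar> * \<bar>f y\<bar>) \<le> ennreal \<bar>b x - av c r\<bar> * ennreal \<bar>f y\<bar> + ennreal (\<bar>b y - av c r\<bar> * \<bar>f y\<bar>)" for y
      proof -
        have "\<bar>b x - b y\<bar> * \<bar>f y\<bar> \<le> (\<bar>b x - av c r\<bar> + \<bar>b y - av c r\<bar>) * \<bar>f y\<bar>" by (intro mult_right_mono) auto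
        then have "ennreal (\<bar>b x - b y\<bar> * \<bar>f y\<bar>) \<le> ennreal (\<bar>b x - av c r\<bar> * \<bar>f y\<bar> + \<bar>b y - av c r\<bar> * \<bar>f y\<bar>)"
          by (intro ennreal_leI) (simp add: algebra_simps)
        then show ?thesis by (simp add: ennreal_mult)
      qed
      have "(\<integral>\<^sup>+y\<in>cube c r. ennreal (\<bar>b x - b y\<bar> * \<bar>f y\<bar>) \<partial>lebesgue) \<le>
          (\<integral>\<^sup>+y. ennreal \<bar>b x - av c r\<bar> * (ennreal \<bar>f y\<bar> * indicator (cube c r) y) +
             ennreal (\<bar>b y - av c r\<bar> * \<bar>f y\<bar>) * indicator (cube c r) y \<partial>lebesgue)"
        using ptw by (intro nn_integral_mono) (auto split: split_indicator)
      also have "\<dots> = ?I2 + ?I1"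
        by (subst nn_integral_add) (auto simp: nn_integral_cmult)
      finally have le: "(\<integral>\<^sup>+y\<in>cube c r. ennreal (\<bar>b x - b y\<bar> * \<bar>f y\<bar>) \<partial>lebesgue) \<le> ?I2 + ?I1" .
      have "ennreal (s / 2 * r ^ CARD('n)) < ?I1 \<or> ennreal (s / 2 * r ^ CARD('n)) < ?I2"
      proof (rule ccontr)
        assume "\<not> ?thesis"
        then have "?I2 + ?I1 \<le> ennreal (s / 2 * r ^ CARD('n)) + ennreal (s / 2 * r ^ CARD('n))"
          by (intro add_mono) auto
        also have "\<dots> = ennreal (s * r ^ CARD('n))" using s r by (simp add: ennreal_plus[symmetric] del: ennreal_plus)
        finally show False using le big by simp
      qed
      then show ?thesis
        using E1(3)[OF r _ sub] E2(3)[OF r _ sub xc] False xc by (meson UnCI less_imp_le not_le subsetD)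
    qed
  qed
qed

end

section \<open>From the maximal commutator to the commutator of the maximal function\<close>

lemma ennreal_divide_le_iff:
  assumes "0 < v"
  shows "a / ennreal v \<le> T \<longleftrightarrow> a \<le> T * ennreal v"
proof -
  have "T < a / ennreal v \<longleftrightarrow> T * ennreal v < a"
    using assms by (cases a; cases T)
      (auto simp: divide_ennreal ennreal_mult[symmetric] ennreal_less_iff field_simps ennreal_top_mult ennreal_top_divide)
  then show ?thesis by (simp add: not_less[symmetric])
qed

lemma maximal_le_iff:
  fixes f :: "real ^ 'n::finite \<Rightarrow> real"
  shows "maximal f x \<le> T \<longleftrightarrow> (\<forall>c r. 0 < r \<longrightarrow> x \<in> cube c r \<longrightarrow>
    (\<integral>\<^sup>+y\<in>cube c r. ennreal \<bar>f y\<bar> \<partial>lebesgue) \<le> T * ennreal (r ^ CARD('n)))"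
proof -
  have "maximal f x \<le> T \<longleftrightarrow> (\<forall>c r. 0 < r \<longrightarrow> x \<in> cube c r \<longrightarrow>
    (\<integral>\<^sup>+y\<in>cube c r. ennreal \<bar>f y\<bar> \<partial>lebesgue) / emeasure lebesgue (cube c r) \<le> T)"
    unfolding maximal_def SUP_le_iff cubes_eq by auto
  then show ?thesis by (simp add: emeasure_cube ennreal_divide_le_iff)
qed

text \<open>The maximal function is lower semicontinuous: a closed cube through \<open>x\<close> can be enlarged slightly, so that
  \<open>x\<close> becomes interior, while its mean stays above the given level.\<close>

lemma maximal_measurable [measurable]:
  fixes f :: "real ^ 'n::finite \<Rightarrow> real"
  shows "maximal f \<in> borel_measurable lebesgue"
proof (rule borel_measurableI_greater)
  fix T
  have "open {x. T < maximal f x}"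
    unfolding open_subopen[of "{x. T < maximal f x}"]
  proof
    fix x assume "x \<in> {x. T < maximal f x}"
    then have "\<not> maximal f x \<le> T" by simp
    then obtain c r where r: "0 < r" and x: "x \<in> cube c r"
      and big: "T * ennreal (r ^ CARD('n)) < (\<integral>\<^sup>+y\<in>cube c r. ennreal \<bar>f y\<bar> \<partial>lebesgue)"
      unfolding maximal_le_iff by (auto simp: not_le)
    let ?I = "\<integral>\<^sup>+y\<in>cube c r. ennreal \<bar>f y\<bar> \<partial>lebesgue"
    have "T \<noteq> top" using big r by (auto simp: ennreal_top_mult)
    then obtain t where t: "0 \<le> t" "T = ennreal t" by (cases T) auto
    have "((\<lambda>\<delta>. t * (r + 2 * \<delta>) ^ CARD('n)) \<longlongrightarrow> t * (r + 2 * 0) ^ CARD('n)) (at_right 0)"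
      by (intro tendsto_intros)
    then have "((\<lambda>\<delta>. ennreal (t * (r + 2 * \<delta>) ^ CARD('n))) \<longlongrightarrow> ennreal (t * r ^ CARD('n))) (at_right 0)"
      by (intro tendsto_ennrealI) simp
    moreover have "ennreal (t * r ^ CARD('n)) < ?I" using big t r by (simp add: ennreal_mult)
    ultimately have "\<forall>\<^sub>F \<delta> in at_right 0. ennreal (t * (r + 2 * \<delta>) ^ CARD('n)) < ?I"
      by (rule order_tendstoD(2))
    moreover have "\<forall>\<^sub>F \<delta> in at_right (0 :: real). 0 < \<delta>" by (rule eventually_at_right_less)
    ultimately have "\<forall>\<^sub>F \<delta> in at_right 0. ennreal (t * (r + 2 * \<delta>) ^ CARD('n)) < ?I \<and> 0 < \<delta>"
      by eventually_elim simp
    then obtain \<delta> where \<delta>: "ennreal (t * (r + 2 * \<delta>) ^ CARD('n)) < ?I" "0 < \<delta>"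
      using eventually_happens trivial_limit_at_right_real by blast
    define c' where "c' = (\<chi> i. c $ i - \<delta>)"
    let ?R = "cube c' (r + 2 * \<delta>)"
    have sub: "cube c r \<subseteq> ?R" using r \<delta>(2) by (simp add: cube_subset_iff c'_def)
    have "z \<in> {x. T < maximal f x}" if z: "z \<in> interior ?R" for z
    proof -
      have "?I \<le> (\<integral>\<^sup>+y\<in>?R. ennreal \<bar>f y\<bar> \<partial>lebesgue)"
        using sub by (intro nn_integral_mono) (auto split: split_indicator)
      then have "T * ennreal ((r + 2 * \<delta>) ^ CARD('n)) < (\<integral>\<^sup>+y\<in>?R. ennreal \<bar>f y\<bar> \<partial>lebesgue)"
        using \<delta> t r by (simp add: ennreal_mult)
      moreover have "z \<in> ?R" "0 < r + 2 * \<delta>" using z interior_subset r \<delta>(2) by auto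
      ultimately have "\<not> maximal f z \<le> T" unfolding maximal_le_iff by (metis not_le)
      then show ?thesis by simp
    qed
    moreover have "x \<in> interior ?R"
      using x \<delta>(2) unfolding mem_interior_cube by (simp add: mem_cube c'_def) (smt (verit))
    ultimately show "\<exists>S. open S \<and> x \<in> S \<and> S \<subseteq> {x. T < maximal f x}" by blast
  qed
  then show "{x \<in> space lebesgue. T < maximal f x} \<in> sets lebesgue" by simp
qed

lemma commutator_max_measurable:
  fixes b f :: "real ^ 'n::finite \<Rightarrow> real"
  assumes [measurable]: "b \<in> borel_measurable lebesgue"
  shows "commutator_max b f \<in> borel_measurable lebesgue"
  unfolding commutator_max_def by measurable

text \<open>With \<open>\<beta> = b\<^sup>+\<close>, the estimates \<open>M(b f) \<le> (\<beta> x + L) Mf + s\<close> and \<open>\<beta> x Mf \<le> M(b f) + s\<close> follow cube by cube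
  from \<open>\<beta> \<le> |b| \<le> \<beta> + L\<close>. Both maximal functions are finite at \<open>x\<close>, so the extended real difference is an
  ordinary one.\<close>

lemma commutator_max_le:
  fixes b f :: "real ^ 'n::finite \<Rightarrow> real"
  assumes [measurable]: "b \<in> borel_measurable lebesgue" "f \<in> borel_measurable lebesgue"
    and negAE: "AE y in lebesgue. neg_part b y \<le> L" and negx: "neg_part b x \<le> L"
    and s: "0 \<le> s" and t: "0 \<le> t"
    and comm: "\<And>c r. 0 < r \<Longrightarrow> x \<in> cube c r \<Longrightarrow>
      (\<integral>\<^sup>+y\<in>cube c r. ennreal (\<bar>pos_part b x - pos_part b y\<bar> * \<bar>f y\<bar>) \<partial>lebesgue) \<le> ennreal (s * r ^ CARD('n))"
    and maxf: "\<And>c r. 0 < r \<Longrightarrow> x \<in> cube c r \<Longrightarrow>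
      (\<integral>\<^sup>+y\<in>cube c r. ennreal \<bar>f y\<bar> \<partial>lebesgue) \<le> ennreal (t * r ^ CARD('n))"
  shows "\<bar>commutator_max b f x\<bar> \<le> ereal (s + 2 * L * t)"
proof -
  define \<beta> where "\<beta> = pos_part b x"
  define \<nu> where "\<nu> = neg_part b x"
  have \<beta>\<nu>: "0 \<le> \<beta>" "0 \<le> \<nu>" "b x = \<beta> - \<nu>" "\<nu> \<le> L"
    using negx by (auto simp: \<beta>_def \<nu>_def pos_part_def neg_part_def)
  have L: "0 \<le> L" using \<beta>\<nu> by simp
  have [measurable]: "pos_part b \<in> borel_measurable lebesgue" unfolding pos_part_def by measurable
  have "maximal f x \<le> ennreal t"
    unfolding maximal_le_iff using maxf t by (auto simp: ennreal_mult)
  then obtain m where m: "maximal f x = ennreal m" "0 \<le> m" "m \<le> t"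
    using t by (cases "maximal f x") (auto simp: top_unique)
  have mass: "(\<integral>\<^sup>+y\<in>cube c r. ennreal \<bar>f y\<bar> \<partial>lebesgue) \<le> ennreal m * ennreal (r ^ CARD('n))"
    if "0 < r" "x \<in> cube c r" for c r
    using m(1) that maximal_le_iff[of f x "ennreal m"] by simp
  have "maximal (\<lambda>y. b y * f y) x \<le> ennreal ((\<beta> + L) * m + s)"
    unfolding maximal_le_iff
  proof (intro allI impI)
    fix c r assume r: "0 < r" and xr: "x \<in> cube c r"
    have "AE y in lebesgue. ennreal \<bar>b y * f y\<bar> * indicator (cube c r) y \<le>
        ennreal (\<beta> + L) * (ennreal \<bar>f y\<bar> * indicator (cube c r) y) +
        ennreal (\<bar>pos_part b x - pos_part b y\<bar> * \<bar>f y\<bar>) * indicator (cube c r) y"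
      using negAE
    proof eventually_elim
      case (elim y)
      have "\<bar>b y\<bar> \<le> \<beta> + L + \<bar>pos_part b x - pos_part b y\<bar>"
        using elim unfolding \<beta>_def by (auto simp: pos_part_def neg_part_def)
      then have "\<bar>b y * f y\<bar> \<le> (\<beta> + L + \<bar>pos_part b x - pos_part b y\<bar>) * \<bar>f y\<bar>"
        unfolding abs_mult by (rule mult_right_mono) simp
      then have "ennreal \<bar>b y * f y\<bar> \<le> ennreal ((\<beta> + L) * \<bar>f y\<bar> + \<bar>pos_part b x - pos_part b y\<bar> * \<bar>f y\<bar>)"
        by (intro ennreal_leI) (simp add: algebra_simps)
      then have "ennreal \<bar>b y * f y\<bar> \<le> ennreal (\<beta> + L) * ennreal \<bar>f y\<bar> + ennreal (\<bar>pos_part b x - pos_part b y\<bar> * \<bar>f y\<bar>)"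
        using \<beta>\<nu> L by (simp only: ennreal_plus ennreal_mult mult_nonneg_nonneg add_nonneg_nonneg abs_ge_zero)
      then show ?case by (auto split: split_indicator)
    qed
    then have "(\<integral>\<^sup>+y\<in>cube c r. ennreal \<bar>b y * f y\<bar> \<partial>lebesgue) \<le> (\<integral>\<^sup>+y. ennreal (\<beta> + L) * (ennreal \<bar>f y\<bar> * indicator (cube c r) y) +
        ennreal (\<bar>pos_part b x - pos_part b y\<bar> * \<bar>f y\<bar>) * indicator (cube c r) y \<partial>lebesgue)"
      by (rule nn_integral_mono_AE)
    also have "\<dots> = ennreal (\<beta> + L) * (\<integral>\<^sup>+y\<in>cube c r. ennreal \<bar>f y\<bar> \<partial>lebesgue) +
        (\<integral>\<^sup>+y\<in>cube c r. ennreal (\<bar>pos_part b x - pos_part b y\<bar> * \<bar>f y\<bar>) \<partial>lebesgue)"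
      by (subst nn_integral_add) (auto simp: nn_integral_cmult)
    also have "\<dots> \<le> ennreal (\<beta> + L) * (ennreal m * ennreal (r ^ CARD('n))) + ennreal (s * r ^ CARD('n))"
      by (intro add_mono mult_left_mono mass comm r xr) auto
    also have "\<dots> = ennreal ((\<beta> + L) * (m * r ^ CARD('n)) + s * r ^ CARD('n))"
      using \<beta>\<nu> L m r s by (simp add: ennreal_mult[symmetric] ennreal_plus[symmetric] del: ennreal_plus)
    also have "(\<beta> + L) * (m * r ^ CARD('n)) + s * r ^ CARD('n) = ((\<beta> + L) * m + s) * r ^ CARD('n)"
      by (simp add: algebra_simps)
    also have "ennreal \<dots> = ennreal ((\<beta> + L) * m + s) * ennreal (r ^ CARD('n))"
      using \<beta>\<nu> L m r s by (intro ennreal_mult) auto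
    finally show "(\<integral>\<^sup>+y\<in>cube c r. ennreal \<bar>b y * f y\<bar> \<partial>lebesgue) \<le> ennreal ((\<beta> + L) * m + s) * ennreal (r ^ CARD('n))" .
  qed
  moreover have "0 \<le> (\<beta> + L) * m + s" using \<beta>\<nu> L m s by simp
  ultimately obtain M where M: "maximal (\<lambda>y. b y * f y) x = ennreal M" "0 \<le> M" "M \<le> (\<beta> + L) * m + s"
    by (cases "maximal (\<lambda>y. b y * f y) x") (auto simp: top_unique)
  have low: "\<beta> * m \<le> M + s"
  proof (cases "\<beta> = 0")
    case False
    then have \<beta>: "0 < \<beta>" using \<beta>\<nu> by simp
    have "maximal f x \<le> ennreal ((M + s) / \<beta>)"
      unfolding maximal_le_iff
    proof (intro allI impI)
      fix c r assume r: "0 < r" and xr: "x \<in> cube c r"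
      let ?I = "\<integral>\<^sup>+y\<in>cube c r. ennreal \<bar>f y\<bar> \<partial>lebesgue"
      have ptw: "ennreal \<beta> * ennreal \<bar>f y\<bar> \<le> ennreal \<bar>b y * f y\<bar> + ennreal (\<bar>pos_part b x - pos_part b y\<bar> * \<bar>f y\<bar>)" for y
      proof -
        have "\<beta> * \<bar>f y\<bar> \<le> (\<bar>b y\<bar> + \<bar>pos_part b x - pos_part b y\<bar>) * \<bar>f y\<bar>"
          unfolding \<beta>_def by (intro mult_right_mono) (auto simp: pos_part_def)
        then have "ennreal (\<beta> * \<bar>f y\<bar>) \<le> ennreal (\<bar>b y * f y\<bar> + \<bar>pos_part b x - pos_part b y\<bar> * \<bar>f y\<bar>)"
          by (intro ennreal_leI) (simp add: algebra_simps abs_mult)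
        then show ?thesis using \<beta> by (simp only: ennreal_plus ennreal_mult mult_nonneg_nonneg abs_ge_zero less_imp_le)
      qed
      have "ennreal \<beta> * ?I = (\<integral>\<^sup>+y. ennreal \<beta> * (ennreal \<bar>f y\<bar> * indicator (cube c r) y) \<partial>lebesgue)"
        by (rule nn_integral_cmult[symmetric]) measurable
      also have "\<dots> \<le> (\<integral>\<^sup>+y. ennreal \<bar>b y * f y\<bar> * indicator (cube c r) y +
          ennreal (\<bar>pos_part b x - pos_part b y\<bar> * \<bar>f y\<bar>) * indicator (cube c r) y \<partial>lebesgue)"
        using ptw by (intro nn_integral_mono) (auto split: split_indicator)
      also have "\<dots> = (\<integral>\<^sup>+y\<in>cube c r. ennreal \<bar>b y * f y\<bar> \<partial>lebesgue) +
          (\<integral>\<^sup>+y\<in>cube c r. ennreal (\<bar>pos_part b x - pos_part b y\<bar> * \<bar>f y\<bar>) \<partial>lebesgue)"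
        by (rule nn_integral_add) measurable
      also have "\<dots> \<le> ennreal M * ennreal (r ^ CARD('n)) + ennreal (s * r ^ CARD('n))"
        using M(1) maximal_le_iff[of "\<lambda>y. b y * f y" x "ennreal M"] r xr by (intro add_mono comm) auto
      also have "\<dots> = ennreal ((M + s) * r ^ CARD('n))"
        using M s r by (simp add: ennreal_mult[symmetric] ennreal_plus[symmetric] algebra_simps del: ennreal_plus)
      finally have le: "ennreal \<beta> * ?I \<le> ennreal ((M + s) * r ^ CARD('n))" .
      have "?I \<noteq> top" using mass[OF r xr] by (auto simp: ennreal_mult[symmetric] top_unique m r less_imp_le)
      then obtain i where i: "0 \<le> i" "?I = ennreal i" by (cases ?I) auto
      have "\<beta> * i \<le> (M + s) * r ^ CARD('n)"
        using le \<beta> i M s r unfolding i(2) by (simp add: ennreal_mult[symmetric])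
      then have "i \<le> (M + s) / \<beta> * r ^ CARD('n)" using \<beta> by (simp add: field_simps)
      then have "?I \<le> ennreal ((M + s) / \<beta> * r ^ CARD('n))" unfolding i(2) by (rule ennreal_leI)
      also have "\<dots> = ennreal ((M + s) / \<beta>) * ennreal (r ^ CARD('n))"
        using M s \<beta> r by (intro ennreal_mult) auto
      finally show "?I \<le> ennreal ((M + s) / \<beta>) * ennreal (r ^ CARD('n))" .
    qed
    then have "m \<le> (M + s) / \<beta>" using m M s \<beta> by simp
    then show ?thesis using \<beta> by (simp add: field_simps)
  qed (use M s in simp)
  have comm_eq: "commutator_max b f x = ereal (M - b x * m)"
    unfolding commutator_max_def using M m by (simp add: enn2ereal_ennreal)
  have "\<nu> * m \<le> L * t" "L * m \<le> L * t" "0 \<le> \<nu> * m" using \<beta>\<nu> m L by (auto intro: mult_mono)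
  then have "\<bar>M - b x * m\<bar> \<le> s + 2 * L * t"
    using M(3) low s by (simp add: \<beta>\<nu>(3) algebra_simps abs_le_iff)
  then show ?thesis unfolding comm_eq by simp
qed

lemma cube_powr_normalization:
  fixes a :: "real ^ 'n::finite"
  assumes "0 < r"
  shows "measure lebesgue (cube a r) powr (lam / real CARD('n)) = r powr lam"
  using assms by (simp add: measure_cube powr_realpow[symmetric] powr_powr)

text \<open>The strict inequality lets the infimum in the Luxemburg norm be replaced by an admissible value.\<close>

lemma ZM_norm_Phi_mass:
  fixes f :: "real ^ 'n::finite \<Rightarrow> real"
  assumes lt: "ZM_norm lam f < ennreal N" and r: "0 < r"
  shows "(\<integral>\<^sup>+y\<in>cube a r. ennreal (Phi (\<bar>f y\<bar> / (N * r powr - lam))) \<partial>lebesgue) \<le> ennreal (r ^ CARD('n))"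
proof -
  have N: "0 < N" using lt by (metis ennreal_neg not_less not_less_zero)
  have "ennreal (r powr lam) * LlogL_norm (cube a r) f \<le> ZM_norm lam f"
    unfolding ZM_norm_def cube_powr_normalization[OF r, of a lam, symmetric]
    by (rule SUP_upper) (rule cube_in_cubes[OF r])
  then have small: "ennreal (r powr lam) * LlogL_norm (cube a r) f < ennreal N" using lt by simp
  have "LlogL_norm (cube a r) f < ennreal (N * r powr - lam)"
  proof (rule ccontr)
    assume "\<not> ?thesis"
    then have "ennreal (r powr lam) * ennreal (N * r powr - lam) \<le> ennreal (r powr lam) * LlogL_norm (cube a r) f"
      by (intro mult_left_mono) auto
    moreover have "ennreal (r powr lam) * ennreal (N * r powr - lam) = ennreal N"
      using r N by (simp add: ennreal_mult[symmetric] mult.left_commute[of _ N] powr_add[symmetric])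
    ultimately show False using small by simp
  qed
  then obtain \<alpha> where \<alpha>: "0 < \<alpha>" "ennreal \<alpha> < ennreal (N * r powr - lam)"
    "(\<integral>\<^sup>+y\<in>cube a r. ennreal (Phi (\<bar>f y\<bar> / \<alpha>)) \<partial>lebesgue) / emeasure lebesgue (cube a r) \<le> 1"
    unfolding LlogL_norm_def Phi_def by (auto simp: INF_less_iff)
  have "\<alpha> \<le> N * r powr - lam" using \<alpha>(1,2) by (simp add: ennreal_less_iff)
  then have "(\<integral>\<^sup>+y\<in>cube a r. ennreal (Phi (\<bar>f y\<bar> / (N * r powr - lam))) \<partial>lebesgue) \<le> (\<integral>\<^sup>+y\<in>cube a r. ennreal (Phi (\<bar>f y\<bar> / \<alpha>)) \<partial>lebesgue)"
    using \<alpha>(1) by (intro nn_integral_mono mult_right_mono ennreal_leI Phi_mono divide_left_mono) auto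
  also have "\<dots> \<le> ennreal (r ^ CARD('n))"
    using \<alpha>(3) r by (simp add: emeasure_cube ennreal_divide_le_iff)
  finally show ?thesis .
qed

lemma bmo_norm_osc:
  fixes g :: "real ^ 'n::finite \<Rightarrow> real"
  assumes "bmo_norm g \<le> T" and r: "0 < r"
  shows "(\<integral>\<^sup>+y\<in>cube a r. ennreal \<bar>g y - average (cube a r) g\<bar> \<partial>lebesgue) \<le> T * ennreal (r ^ CARD('n))"
proof -
  have "(\<integral>\<^sup>+y\<in>cube a r. ennreal \<bar>g y - average (cube a r) g\<bar> \<partial>lebesgue) / emeasure lebesgue (cube a r) \<le> bmo_norm g"
    unfolding bmo_norm_def by (rule SUP_upper) (rule cube_in_cubes[OF r])
  also have "\<dots> \<le> T" by fact
  finally show ?thesis using r by (simp add: emeasure_cube ennreal_divide_le_iff)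
qed

lemma pos_part_integrable:
  assumes "set_integrable lebesgue S b"
  shows "set_integrable lebesgue S (pos_part b)"
proof -
  have "integrable lebesgue (\<lambda>x. max (indicator S x *\<^sub>R b x) 0)"
    using assms unfolding set_integrable_def by (intro integrable_max) auto
  moreover have "(\<lambda>x. max (indicator S x *\<^sub>R b x) 0) = (\<lambda>x. indicator S x *\<^sub>R pos_part b x)"
    by (auto simp: pos_part_def split: split_indicator)
  ultimately show ?thesis unfolding set_integrable_def by simp
qed

text \<open>The positive part is 1-Lipschitz, so \<open>b\<^sup>+\<close> deviates from \<open>(b\<^sub>Q)\<^sup>+\<close> at most as much as \<open>b\<close> from \<open>b\<^sub>Q\<close>;
  replacing \<open>(b\<^sub>Q)\<^sup>+\<close> by the average of \<open>b\<^sup>+\<close> costs a factor 2.\<close>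

lemma bmo_norm_pos_part_le:
  fixes b :: "real ^ 'n::finite \<Rightarrow> real"
  assumes b: "\<And>a r. set_integrable lebesgue (cube a r) b"
  shows "bmo_norm (pos_part b) \<le> 2 * bmo_norm b"
  unfolding bmo_norm_def[of "pos_part b"]
proof (rule SUP_least)
  fix Q :: "(real ^ 'n) set" assume "Q \<in> cubes"
  then obtain a r where Q: "Q = cube a r" and r: "0 < r" by (auto simp: cubes_eq)
  have [measurable]: "b \<in> borel_measurable lebesgue" using b by (rule locally_integrable_measurable)
  have [measurable]: "pos_part b \<in> borel_measurable lebesgue" unfolding pos_part_def by measurable
  define \<gamma> where "\<gamma> = max (average Q b) 0"
  let ?d = "\<bar>average Q (pos_part b) - \<gamma>\<bar>"
  let ?J = "\<integral>\<^sup>+y\<in>Q. ennreal \<bar>pos_part b y - \<gamma>\<bar> \<partial>lebesgue"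
  have "(\<integral>\<^sup>+y\<in>Q. ennreal \<bar>pos_part b y - average Q (pos_part b)\<bar> \<partial>lebesgue) \<le>
      (\<integral>\<^sup>+y. ennreal \<bar>pos_part b y - \<gamma>\<bar> * indicator Q y + ennreal ?d * indicator Q y \<partial>lebesgue)"
  proof (rule nn_integral_mono)
    fix y
    have "ennreal \<bar>pos_part b y - average Q (pos_part b)\<bar> \<le> ennreal (\<bar>pos_part b y - \<gamma>\<bar> + ?d)" by (intro ennreal_leI) auto
    then show "ennreal \<bar>pos_part b y - average Q (pos_part b)\<bar> * indicator Q y \<le>
        ennreal \<bar>pos_part b y - \<gamma>\<bar> * indicator Q y + ennreal ?d * indicator Q y"
      by (auto split: split_indicator)
  qed
  also have "\<dots> = ?J + ennreal ?d * ennreal (r ^ CARD('n))"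
    using r by (subst nn_integral_add) (auto simp: Q nn_integral_cmult emeasure_cube)
  also have "\<dots> = ?J + ennreal (?d * r ^ CARD('n))" using r by (simp add: ennreal_mult)
  also have "\<dots> \<le> ?J + ?J"
    unfolding Q by (intro add_left_mono average_deviation r pos_part_integrable b)
  also have "\<dots> = 2 * ?J" by (simp add: mult_2)
  also have "?J \<le> (\<integral>\<^sup>+y\<in>Q. ennreal \<bar>b y - average Q b\<bar> \<partial>lebesgue)"
    by (intro nn_integral_mono mult_right_mono ennreal_leI) (auto simp: \<gamma>_def pos_part_def)
  also have "\<dots> \<le> bmo_norm b * ennreal (r ^ CARD('n))" unfolding Q by (intro bmo_norm_osc r) simp
  finally have "(\<integral>\<^sup>+y\<in>Q. ennreal \<bar>pos_part b y - average Q (pos_part b)\<bar> \<partial>lebesgue) \<le> 2 * bmo_norm b * ennreal (r ^ CARD('n))"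
    by (simp add: mult_left_mono mult.assoc)
  then show "(\<integral>\<^sup>+y\<in>Q. ennreal \<bar>pos_part b y - average Q (pos_part b)\<bar> \<partial>lebesgue) / emeasure lebesgue Q \<le> 2 * bmo_norm b"
    using r by (simp add: Q emeasure_cube ennreal_divide_le_iff)
qed

definition weak_const :: "'n::finite itself \<Rightarrow> real \<Rightarrow> real" where
  "weak_const _ lam = 4 * vitali_factor TYPE('n) *
     (3 ^ CARD('n) * (80 * vitali_factor TYPE('n) + 34 + real CARD('n) / (lam * ln 2)) + 3 ^ CARD('n))"

lemma weak_const_pos:
  assumes "0 < lam"
  shows "0 < weak_const TYPE('n::finite) lam"
proof -
  have "0 \<le> real CARD('n) / (lam * ln 2)" using assms by simp
  then have "0 < 3 ^ CARD('n) * (80 * vitali_factor TYPE('n) + 34 + real CARD('n) / (lam * ln 2)) + (3 :: real) ^ CARD('n)"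
    using vitali_factor_ge1[where 'n='n] by (intro add_nonneg_pos mult_nonneg_nonneg) auto
  then show ?thesis using vitali_factor_ge1[where 'n='n] by (simp add: weak_const_def)
qed

text \<open>The level \<open>\<tau>\<close> is split evenly: \<open>\<tau> / 2\<close> for the maximal commutator, and \<open>\<tau> / (4 B)\<close> for the maximal
  function, which occurs with the factor \<open>2 B\<close>.\<close>

lemma commutator_max_WZM_norm_le:
  fixes b f :: "real ^ 'n::finite \<Rightarrow> real" and B N lam :: real
  assumes B: "0 < B" and N: "0 < N" and lam: "0 < lam"
    and b: "\<And>a r. set_integrable lebesgue (cube a r) b"
    and f [measurable]: "f \<in> borel_measurable lebesgue"
    and bmo: "bmo_norm (pos_part b) \<le> ennreal B"
    and inf: "Linfty_norm (neg_part b) \<le> ennreal B"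
    and ZM: "ZM_norm lam f < ennreal N"
  shows "WZM_norm lam (commutator_max b f) \<le> ennreal (weak_const TYPE('n) lam * B * N)"
proof -
  have [measurable]: "b \<in> borel_measurable lebesgue" using b by (rule locally_integrable_measurable)
  have [measurable]: "neg_part b \<in> borel_measurable lebesgue" unfolding neg_part_def by measurable
  define \<Lambda> where "\<Lambda> = 2 * vitali_factor TYPE('n) * B"
  interpret commutator_pair "pos_part b" B \<Lambda> f lam N
  proof unfold_locales
    show "set_integrable lebesgue (cube a r) (pos_part b)" for a r by (intro pos_part_integrable b)
    show "(\<integral>\<^sup>+y\<in>cube a r. ennreal \<bar>pos_part b y - average (cube a r) (pos_part b)\<bar> \<partial>lebesgue) \<le> ennreal (B * r ^ CARD('n))"
      if "0 < r" for a r
      using bmo_norm_osc[OF bmo that, of a] B that by (simp add: ennreal_mult)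
    show "(\<integral>\<^sup>+y\<in>cube a r. ennreal (Phi (\<bar>f y\<bar> / (N * r powr - lam))) \<partial>lebesgue) \<le> ennreal (r ^ CARD('n))" if "0 < r" for a r
      using ZM_norm_Phi_mass[OF ZM that] .
  qed (use B N lam \<Lambda>_def f in auto)
  have neg: "AE y in lebesgue. neg_part b y \<le> B"
  proof -
    have "AE y in lebesgue. ennreal \<bar>neg_part b y\<bar> \<le> Linfty_norm (neg_part b)"
      unfolding Linfty_norm_def by (rule esssup_AE)
    then show ?thesis
    proof eventually_elim
      case (elim y)
      then have "ennreal \<bar>neg_part b y\<bar> \<le> ennreal B" using inf by (rule order_trans)
      then show ?case using B by (simp add: abs_le_iff)
    qed
  qed
  then obtain Z where Z: "Z \<in> null_sets lebesgue" "\<And>y. y \<notin> Z \<Longrightarrow> neg_part b y \<le> B"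
    by (elim AE_E) (auto simp: null_sets_def)
  define K where "K = weak_const TYPE('n) lam"
  have K: "0 < K" unfolding K_def by (rule weak_const_pos[OF lam])
  have weak: "emeasure lebesgue {x \<in> cube a q. ereal \<tau> < \<bar>commutator_max b f x\<bar>} \<le> ennreal (K * B * height q * q ^ CARD('n) / \<tau>)"
    if q: "0 < q" and \<tau>: "0 < \<tau>" for a q \<tau>
  proof -
    define Kc where "Kc = 3 ^ CARD('n) * (80 * vitali_factor TYPE('n) + 34 + real CARD('n) / (lam * ln 2))"
    have "0 \<le> real CARD('n) / (lam * ln 2)" using lam by simp
    then have Kc: "0 \<le> Kc" using vitali_factor_ge1[where 'n='n] unfolding Kc_def by (intro mult_nonneg_nonneg) auto
    have \<tau>': "0 < \<tau> / 2" "0 < \<tau> / (4 * B)" using \<tau> B by auto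
    obtain E1 where E1: "E1 \<in> sets lebesgue"
      "emeasure lebesgue E1 \<le> ennreal (Kc * (\<Lambda> * height q * q ^ CARD('n) / (\<tau> / 2)))"
      "\<And>x c r. x \<in> cube a q \<Longrightarrow> 0 < r \<Longrightarrow> x \<in> cube c r \<Longrightarrow>
         ennreal (\<tau> / 2 * r ^ CARD('n)) < (\<integral>\<^sup>+y\<in>cube c r. ennreal (\<bar>pos_part b x - pos_part b y\<bar> * \<bar>f y\<bar>) \<partial>lebesgue) \<Longrightarrow> x \<in> E1"
      by (rule maximal_commutator_weak_type[OF q \<tau>'(1), where a=a, folded Kc_def]) (rule that)
    obtain E2 where E2: "E2 \<in> sets lebesgue"
      "emeasure lebesgue E2 \<le> ennreal (vitali_factor TYPE('n) * 3 ^ CARD('n) * (height q * q ^ CARD('n) / (\<tau> / (4 * B))))"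
      "\<And>x c r. x \<in> cube a q \<Longrightarrow> 0 < r \<Longrightarrow> x \<in> cube c r \<Longrightarrow>
         ennreal (\<tau> / (4 * B) * r ^ CARD('n)) < (\<integral>\<^sup>+y\<in>cube c r. ennreal \<bar>f y\<bar> \<partial>lebesgue) \<Longrightarrow> x \<in> E2"
      by (rule maximal_weak_type[OF q \<tau>'(2), where a=a]) (rule that)
    have "{x \<in> cube a q. ereal \<tau> < \<bar>commutator_max b f x\<bar>} \<subseteq> (E1 \<union> E2) \<union> Z"
    proof
      fix x assume "x \<in> {x \<in> cube a q. ereal \<tau> < \<bar>commutator_max b f x\<bar>}"
      then have x: "x \<in> cube a q" "ereal \<tau> < \<bar>commutator_max b f x\<bar>" by auto
      show "x \<in> (E1 \<union> E2) \<union> Z"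
      proof (rule ccontr)
        assume out: "x \<notin> (E1 \<union> E2) \<union> Z"
        have "\<bar>commutator_max b f x\<bar> \<le> ereal (\<tau> / 2 + 2 * B * (\<tau> / (4 * B)))"
        proof (rule commutator_max_le[OF _ _ neg])
          show "neg_part b x \<le> B" using Z(2) out by blast
          show "(\<integral>\<^sup>+y\<in>cube c r. ennreal (\<bar>pos_part b x - pos_part b y\<bar> * \<bar>f y\<bar>) \<partial>lebesgue) \<le> ennreal (\<tau> / 2 * r ^ CARD('n))"
            if "0 < r" "x \<in> cube c r" for c r using E1(3)[OF x(1) that] out by (meson UnCI not_le)
          show "(\<integral>\<^sup>+y\<in>cube c r. ennreal \<bar>f y\<bar> \<partial>lebesgue) \<le> ennreal (\<tau> / (4 * B) * r ^ CARD('n))"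
            if "0 < r" "x \<in> cube c r" for c r using E2(3)[OF x(1) that] out by (meson UnCI not_le)
        qed (use \<tau>' in auto)
        moreover have "\<tau> / 2 + 2 * B * (\<tau> / (4 * B)) = \<tau>" using B by simp
        ultimately show False using x(2) by simp
      qed
    qed
    then have "emeasure lebesgue {x \<in> cube a q. ereal \<tau> < \<bar>commutator_max b f x\<bar>} \<le> emeasure lebesgue ((E1 \<union> E2) \<union> Z)"
      using E1(1) E2(1) Z(1) by (intro emeasure_mono) auto
    also have "\<dots> = emeasure lebesgue (E1 \<union> E2)" using E1(1) E2(1) Z(1) by (intro emeasure_Un_null_set) auto
    also have "\<dots> \<le> emeasure lebesgue E1 + emeasure lebesgue E2" using E1(1) E2(1) by (rule emeasure_subadditive)
    also have "\<dots> \<le> ennreal (Kc * (\<Lambda> * height q * q ^ CARD('n) / (\<tau> / 2))) +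
        ennreal (vitali_factor TYPE('n) * 3 ^ CARD('n) * (height q * q ^ CARD('n) / (\<tau> / (4 * B))))"
      by (intro add_mono E1 E2)
    also have "\<dots> = ennreal (Kc * (\<Lambda> * height q * q ^ CARD('n) / (\<tau> / 2)) +
        vitali_factor TYPE('n) * 3 ^ CARD('n) * (height q * q ^ CARD('n) / (\<tau> / (4 * B))))"
      using Kc \<Lambda>_pos height_pos[OF q] q \<tau> B vitali_factor_ge1[where 'n='n] by (intro ennreal_plus[symmetric]) auto
    also have "Kc * (\<Lambda> * height q * q ^ CARD('n) / (\<tau> / 2)) +
        vitali_factor TYPE('n) * 3 ^ CARD('n) * (height q * q ^ CARD('n) / (\<tau> / (4 * B))) = K * B * height q * q ^ CARD('n) / \<tau>"
      unfolding K_def weak_const_def Kc_def[symmetric] \<Lambda>_def by (simp add: field_simps add_divide_distrib)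
    finally show ?thesis .
  qed
  have norm: "weak_LlogL_norm (cube a q) (commutator_max b f) \<le> ennreal (K * B * height q)" if q: "0 < q" for a q
    unfolding weak_LlogL_norm_def
  proof (rule INF_lower, rule CollectI, rule conjI)
    let ?\<alpha> = "K * B * height q"
    show \<alpha>: "0 < ?\<alpha>" using K B height_pos[OF q] by simp
    show "(SUP t \<in> {0::real<..}. emeasure lebesgue {x \<in> cube a q. ereal (?\<alpha> * t) < \<bar>commutator_max b f x\<bar>}
        / emeasure lebesgue (cube a q) / ennreal (1 / t * (1 + logplus (1 / t)))) \<le> 1"
    proof (rule SUP_least)
      fix t :: real assume "t \<in> {0<..}"
      then have t: "0 < t" by simp
      have "emeasure lebesgue {x \<in> cube a q. ereal (?\<alpha> * t) < \<bar>commutator_max b f x\<bar>} \<le> ennreal (?\<alpha> * q ^ CARD('n) / (?\<alpha> * t))"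
        using \<alpha> t by (intro weak q) simp
      also have "?\<alpha> * q ^ CARD('n) / (?\<alpha> * t) = 1 / t * q ^ CARD('n)" using K B height_pos[OF q] by simp
      also have "ennreal (1 / t * q ^ CARD('n)) \<le> ennreal (Phi (1 / t) * q ^ CARD('n))"
        using t q by (intro ennreal_leI mult_right_mono Phi_ge) auto
      also have "\<dots> = 1 * ennreal (Phi (1 / t)) * ennreal (q ^ CARD('n))"
        using t q Phi_nonneg[of "1 / t"] by (simp add: ennreal_mult)
      finally have "emeasure lebesgue {x \<in> cube a q. ereal (?\<alpha> * t) < \<bar>commutator_max b f x\<bar>} \<le>
          1 * ennreal (Phi (1 / t)) * ennreal (q ^ CARD('n))" .
      moreover have "0 < Phi (1 / t)" using Phi_ge[of "1 / t"] t by (smt (verit) zero_less_divide_1_iff)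
      ultimately show "emeasure lebesgue {x \<in> cube a q. ereal (?\<alpha> * t) < \<bar>commutator_max b f x\<bar>}
        / emeasure lebesgue (cube a q) / ennreal (1 / t * (1 + logplus (1 / t))) \<le> 1"
        using q unfolding Phi_def[symmetric] by (simp add: emeasure_cube ennreal_divide_le_iff)
    qed
  qed
  show ?thesis
    unfolding WZM_norm_def
  proof (rule SUP_least)
    fix Q :: "(real ^ 'n) set" assume "Q \<in> cubes"
    then obtain a q where Q: "Q = cube a q" and q: "0 < q" by (auto simp: cubes_eq)
    have "ennreal (measure lebesgue Q powr (lam / real CARD('n))) * weak_LlogL_norm Q (commutator_max b f) \<le>
        ennreal (q powr lam) * ennreal (K * B * height q)"
      unfolding Q cube_powr_normalization[OF q] by (intro mult_left_mono norm q) auto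
    also have "\<dots> = ennreal (q powr lam * (K * B * height q))"
      using K B height_pos[OF q] by (intro ennreal_mult[symmetric]) auto
    also have "q powr lam * (K * B * height q) = K * B * N"
      using q by (simp add: height_def powr_minus field_simps)
    finally show "ennreal (measure lebesgue Q powr (lam / real CARD('n))) * weak_LlogL_norm Q (commutator_max b f)
        \<le> ennreal (weak_const TYPE('n) lam * B * N)" unfolding K_def .
  qed
qed

text \<open>The estimates above need strictly positive bounds, so the norms \<open>X\<close> and \<open>Y\<close> are replaced by \<open>X + e\<close> and
  \<open>Y + e\<close> with \<open>e\<close> tending to 0. This also covers the degenerate cases in which one of the norms vanishes.\<close>

theorem theorem7p3:
  fixes lam :: real
  assumes "0 < lam" and "lam < real CARD('n::finite)"
  shows "\<exists>c::real. 0 < c \<and>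
    (\<forall>b :: real ^ 'n \<Rightarrow> real. b \<in> BMO \<and> neg_part b \<in> Linfty \<longrightarrow>
      (\<forall>f \<in> ZM lam.
        commutator_max b f \<in> WZM lam \<and>
        WZM_norm lam (commutator_max b f)
          \<le> ennreal c * (bmo_norm (pos_part b) + Linfty_norm (neg_part b)) * ZM_norm lam f))"
proof (intro exI conjI allI impI ballI)
  let ?c = "weak_const TYPE('n) lam"
  show c: "0 < ?c" using assms(1) by (rule weak_const_pos)
  fix b f :: "real ^ 'n \<Rightarrow> real"
  assume b: "b \<in> BMO \<and> neg_part b \<in> Linfty" and f: "f \<in> ZM lam"
  have b_int: "set_integrable lebesgue (cube a r) b" for a r
    using b unfolding BMO_def by (auto intro: locally_integrable_cube)
  have b_meas: "b \<in> borel_measurable lebesgue" using b_int by (rule locally_integrable_measurable)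
  have "bmo_norm (pos_part b) \<le> 2 * bmo_norm b" using b_int by (rule bmo_norm_pos_part_le)
  also have "\<dots> < \<infinity>" using b by (simp add: BMO_def ennreal_mult_less_top)
  finally have "bmo_norm (pos_part b) + Linfty_norm (neg_part b) < \<infinity>" using b by (simp add: Linfty_def)
  then obtain X where X: "0 \<le> X" "bmo_norm (pos_part b) + Linfty_norm (neg_part b) = ennreal X"
    by (cases "bmo_norm (pos_part b) + Linfty_norm (neg_part b)") auto
  obtain Y where Y: "0 \<le> Y" "ZM_norm lam f = ennreal Y" using f by (cases "ZM_norm lam f") (auto simp: ZM_def)
  have bound: "WZM_norm lam (commutator_max b f) \<le> ennreal (?c * (X + e) * (Y + e))" if e: "0 < e" for e
  proof (rule commutator_max_WZM_norm_le)
    show "0 < X + e" "0 < Y + e" "0 < lam" using X Y e assms by auto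
    have "bmo_norm (pos_part b) \<le> ennreal X" "Linfty_norm (neg_part b) \<le> ennreal X"
      unfolding X(2)[symmetric] by auto
    moreover have "ennreal X \<le> ennreal (X + e)" using e by (intro ennreal_leI) simp
    ultimately show "bmo_norm (pos_part b) \<le> ennreal (X + e)" "Linfty_norm (neg_part b) \<le> ennreal (X + e)"
      by (blast intro: order_trans)+
    show "ZM_norm lam f < ennreal (Y + e)" unfolding Y(2) using Y(1) e by (simp add: ennreal_less_iff)
    show "f \<in> borel_measurable lebesgue" using f by (simp add: ZM_def)
  qed (rule b_int)
  have "((\<lambda>e. ennreal (?c * (X + e) * (Y + e))) \<longlongrightarrow> ennreal (?c * (X + 0) * (Y + 0))) (at_right 0)"
    by (intro tendsto_ennrealI tendsto_intros)
  moreover have "\<forall>\<^sub>F e in at_right 0. WZM_norm lam (commutator_max b f) \<le> ennreal (?c * (X + e) * (Y + e))"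
    using eventually_at_right_less[of "0 :: real"] by eventually_elim (rule bound)
  ultimately have "WZM_norm lam (commutator_max b f) \<le> ennreal (?c * X * Y)"
    using tendsto_lowerbound[OF _ _ trivial_limit_at_right_real] by fastforce
  also have "\<dots> = ennreal ?c * (bmo_norm (pos_part b) + Linfty_norm (neg_part b)) * ZM_norm lam f"
    unfolding X(2) Y(2) using c X Y by (simp add: ennreal_mult)
  finally show main: "WZM_norm lam (commutator_max b f)
      \<le> ennreal ?c * (bmo_norm (pos_part b) + Linfty_norm (neg_part b)) * ZM_norm lam f" .
  have "\<dots> < \<infinity>" unfolding X(2) Y(2) using c X Y by (simp add: ennreal_mult[symmetric])
  then show "commutator_max b f \<in> WZM lam"
    unfolding WZM_def using main commutator_max_measurable[OF b_meas, of f] by (auto intro: le_less_trans)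
qed

end
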